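(* Let $\mu$ be a probability measure in $P_2(\mathbb{R}^n)$ with density $e^{-V}$, where $V:\mathbb{R}^n\to\mathbb{R}$ is a $\mathcal C^2$ function satisfying $\mathrm{Hess}(V)\ge R\,\mathrm{Id}_n$ with $R>0$. Then for all $\nu\in P_2(\mathbb{R}^n)$, $$\frac R2\,W_2^2(\mu,\nu)\le \nu(V)-\mu(V)+n-n\exp\Big[\frac1n\Big(\nu(V)-\mu(V)-H(\nu|\mu)\Big)\Big].$$
   Context: $P_2(\mathbb{R}^n)$ is the set of probability measures on $\mathbb{R}^n$ with finite second moment. Densities are with respect to Lebesgue measure. $\mathrm{Hess}(V)\ge R\,\mathrm{Id}_n$ is meant pointwise as symmetric matrices. $\nu(V)=\int V\,d\nu$. $H(\nu|\mu)=\int f\log f\,d\mu$ with $f=\frac{d\nu}{d\mu}$ is the relative entropy, with the convention $H(\nu|\mu)=+\infty$ if $\nu$ is not absolutely continuous with respect to $\mu$ (and $\exp(-\infty)=0$). $W_2(\mu,\nu)=\inf_\pi\big(\iint|y-x|^2\,d\pi(x,y)\big)^{1/2}$, where $\pi$ runs over the couplings of $\mu$ and $\nu$. If $\nu(V)=+\infty$ the right-hand side is understood as $+\infty$. *)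

theory Defs
  imports "HOL-Probability.Probability"
begin

section \<open>Twice continuously differentiable functions and the Hessian\<close>

definition partial_deriv :: "'n \<Rightarrow> (real ^ 'n \<Rightarrow> real) \<Rightarrow> real ^ 'n \<Rightarrow> real" where
  "partial_deriv i f x = frechet_derivative f (at x) (axis i 1)"

definition C1 :: "(real ^ 'n \<Rightarrow> real) \<Rightarrow> bool" where
  "C1 f \<longleftrightarrow> (\<forall>x. f differentiable (at x)) \<and> (\<forall>i. continuous_on UNIV (partial_deriv i f))"

definition C2 :: "(real ^ 'n \<Rightarrow> real) \<Rightarrow> bool" where
  "C2 f \<longleftrightarrow> C1 f \<and> (\<forall>i. C1 (partial_deriv i f))"

definition Hess :: "(real ^ 'n \<Rightarrow> real) \<Rightarrow> real ^ 'n \<Rightarrow> real ^ 'n ^ 'n" where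
  "Hess f x = (\<chi> i j. partial_deriv i (partial_deriv j f) x)"

text \<open>The usual (Loewner) order on symmetric matrices.  Symmetry is not part of the
  definition; for the Hessian of a \<open>C2\<close> function it holds by Schwarz' theorem.\<close>

definition loewner_le :: "real ^ 'n ^ 'n \<Rightarrow> real ^ 'n ^ 'n \<Rightarrow> bool" where
  "loewner_le A B \<longleftrightarrow> (\<forall>v. v \<bullet> (A *v v) \<le> v \<bullet> (B *v v))"


section \<open>Probability measures with finite second moment and the Wasserstein distance\<close>

definition P2 :: "(real ^ 'n) measure set" where
  "P2 = {\<nu>. prob_space \<nu> \<and> sets \<nu> = sets borel \<and> integrable \<nu> (\<lambda>x. (norm x)\<^sup>2)}"

definition couplings ::
  "(real ^ 'n) measure \<Rightarrow> (real ^ 'n) measure \<Rightarrow> ((real ^ 'n) \<times> (real ^ 'n)) measure set" where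
  "couplings \<mu> \<nu> = {\<pi>. prob_space \<pi> \<and> sets \<pi> = sets (borel \<Otimes>\<^sub>M borel) \<and>
     distr \<pi> borel fst = \<mu> \<and> distr \<pi> borel snd = \<nu>}"

text \<open>Only meant for \<open>\<mu>, \<nu> \<in> P2\<close>: then every coupling has finite cost, since
  \<open>|y - x|\<^sup>2 \<le> 2|x|\<^sup>2 + 2|y|\<^sup>2\<close>, the set of couplings contains \<open>\<mu> \<Otimes>\<^sub>M \<nu>\<close>, and the
  real-valued integral and infimum are the genuine ones.\<close>

definition W2 :: "(real ^ 'n) measure \<Rightarrow> (real ^ 'n) measure \<Rightarrow> real" where
  "W2 \<mu> \<nu> = (INF \<pi>\<in>couplings \<mu> \<nu>. sqrt (\<integral>(x, y). (norm (y - x))\<^sup>2 \<partial>\<pi>))"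


section \<open>Extended-valued integral, exponential and relative entropy\<close>

text \<open>Integral of a measurable function as positive part minus negative part, for functions one of
  whose parts has finite integral.  The Bochner integral cannot be used here, as it is \<open>0\<close> (not
  \<open>\<infinity>\<close>) on functions that are not integrable.\<close>

definition ext_integral :: "'a measure \<Rightarrow> ('a \<Rightarrow> real) \<Rightarrow> ereal" where
  "ext_integral M f =
     enn2ereal (\<integral>\<^sup>+x. ennreal (f x) \<partial>M) - enn2ereal (\<integral>\<^sup>+x. ennreal (- f x) \<partial>M)"

definition ext_exp :: "ereal \<Rightarrow> ereal" where
  "ext_exp x = (case x of ereal r \<Rightarrow> ereal (exp r) | PInfty \<Rightarrow> \<infinity> | MInfty \<Rightarrow> 0)"

text \<open>Note that \<open>absolutely_continuous \<mu> \<nu>\<close> means that \<open>\<nu>\<close> is absolutely continuous w.r.t. \<open>\<mu>\<close>, and that \<open>0 * ln 0 = 0\<close>.\<close>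

definition rel_entropy :: "'a measure \<Rightarrow> 'a measure \<Rightarrow> ereal" where
  "rel_entropy \<nu> \<mu> =
     (if absolutely_continuous \<mu> \<nu>
      then ext_integral \<mu> (\<lambda>x. let f = enn2real (RN_deriv \<mu> \<nu> x) in f * ln f)
      else \<infinity>)"

end

theory Submission
  imports Defs
begin

text \<open>
  The proof transports \<open>\<nu>\<close> to \<open>\<mu>\<close> by a map \<open>S\<close> and follows the interpolation
  \<open>z\<^sub>t(y) = (1 - t) S(y) + t y\<close>, which starts at \<open>\<mu>\<close> and moves towards \<open>\<nu>\<close>.  The optimal (Brenier)
  map would do, but only two of its properties matter: \<open>S\<close> is a transport, so that it bounds
  \<open>W\<^sub>2\<close> from above, and its Jacobian determinant factors into nonnegative numbers \<open>q\<^sub>b\<close>.  The triangular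
  Knothe map has both.  Its \<open>b\<close>-th component is the monotone rearrangement of one conditional
  distribution into another, and \<open>q\<^sub>b\<close> is the slope of that rearrangement, so the change of
  variables by \<open>z\<^sub>t\<close> has Jacobian \<open>\<Prod>\<^sub>b (t + (1 - t) q\<^sub>b)\<close>.  Since each \<open>q\<^sub>b\<close> is a ratio of conditional
  densities, no derivative of \<open>S\<close> ever has to be taken.

  Let \<open>g\<close> be the Lebesgue density of \<open>\<nu>\<close>.  Changing variables in the integral of \<open>exp (- V)\<close>, which
  equals 1, gives
  \<open>\<integral> exp (- V(z\<^sub>t)) \<Prod>\<^sub>b (t + (1 - t) q\<^sub>b) / g d\<nu> \<le> 1\<close>
  (\<open>interpolating_transport_euclidean\<close>).  By the Jacobian equation \<open>\<Prod>\<^sub>b q\<^sub>b exp (- V(S)) = g\<close> the integrand is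
  \<open>exp (V(S) - V(z\<^sub>t) + \<Sum>\<^sub>b ln (1 - t + t / q\<^sub>b))\<close>, hence the exponent has nonpositive mean.  Two
  convexity facts bound the exponent from below.  Strong convexity gives
  \<open>V(z\<^sub>t) \<le> (1 - t) V(S) + t V(y) - R/2 t (1 - t) |y - S|\<^sup>2\<close>.  The function \<open>u \<mapsto> ln (1 - t + t exp u)\<close> is convex,
  so it lies above its tangent at \<open>ln E\<close>, where
  \<open>ln E = (\<nu>(V) - \<mu>(V) - H(\<nu>|\<mu>)) / n\<close> is the mean of \<open>- \<Sum>\<^sub>b ln q\<^sub>b / n\<close>; the linear terms then cancel in the
  integral.  What remains is
  \<open>t (\<mu>(V) - \<nu>(V)) + R/2 t (1 - t) \<integral> |y - S|\<^sup>2 d\<nu> + n ln (1 - t + t E) \<le> 0\<close>,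
  and dividing by \<open>t\<close> and letting \<open>t\<close> tend to 0 yields the theorem (\<open>transport_bound\<close>).

  If the entropy is infinite, the exponential term is 0.  The same argument then works for each fixed
  \<open>y\<close>, with \<open>x\<close> distributed according to \<open>\<mu>\<close> in place of \<open>S(y)\<close>: the contraction
  \<open>x \<mapsto> (1 - t) x + t y\<close> has Jacobian \<open>(1 - t)\<^sup>n\<close>, which corresponds to \<open>E = 0\<close>.  Integrating the resulting
  bound over \<open>y\<close> estimates the cost of the independent coupling (\<open>independent_coupling_cost\<close>).
\<close>

section \<open>Monotone rearrangement on the line\<close>

text \<open>The infimum runs over rationals, in the extended reals, so that the quantile depends measurably on
  \<open>u\<close> and on any parameter of \<open>F\<close> without assumptions on \<open>F\<close>.  Composed below with the distribution functions
  of conditional densities, this yields jointly measurable maps although the conditional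
  densities are well-behaved only almost everywhere.\<close>
definition quantile :: "(real \<Rightarrow> real) \<Rightarrow> real \<Rightarrow> real" where
  "quantile F u = real_of_ereal (INF r. if u \<le> F (of_rat r) then ereal (of_rat r) else \<infinity>)"

lemma quantile_inverse:
  assumes "strict_mono F"
  shows "quantile F (F s) = s"
proof -
  have "(INF r. if F s \<le> F (of_rat r) then ereal (of_rat r) else \<infinity>) = ereal s"
  proof (rule INF_eqI)
    fix r :: rat
    show "ereal s \<le> (if F s \<le> F (of_rat r) then ereal (of_rat r) else \<infinity>)"
      using assms by (simp add: strict_mono_less_eq)
  next
    fix y :: ereal
    assume y: "\<And>r. r \<in> UNIV \<Longrightarrow> y \<le> (if F s \<le> F (of_rat r) then ereal (of_rat r) else \<infinity>)"
    show "y \<le> ereal s"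
    proof (rule ccontr)
      assume "\<not> y \<le> ereal s"
      then obtain z where z: "ereal s < ereal z" "ereal z < y"
        using ereal_dense2[of "ereal s" y] by force
      obtain r where r: "s < of_rat r" "of_rat r < z"
        using of_rat_dense[of s z] z(1) by auto
      have "y \<le> ereal (of_rat r)"
        using y[of r] r(1) assms by (simp add: strict_mono_less_eq)
      with z(2) have "ereal z < ereal (of_rat r)" by (rule less_le_trans)
      with r(2) show False by simp
    qed
  qed
  then show ?thesis by (simp add: quantile_def)
qed

lemma measure_density_lborel_singleton:
  fixes k :: "real \<Rightarrow> ennreal"
  assumes [measurable]: "k \<in> borel_measurable borel"
  shows "measure (density lborel k) {x} = 0"
proof -
  have "emeasure (density lborel k) {x} = (\<integral>\<^sup>+y. k y * indicator {x} y \<partial>lborel)"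
    by (simp add: emeasure_density)
  also have "\<dots> = (\<integral>\<^sup>+y. 0 \<partial>(lborel :: real measure))"
    using AE_lborel_singleton[of x] by (intro nn_integral_cong_AE) (auto simp: indicator_def elim!: eventually_mono)
  finally show ?thesis by (simp add: measure_def)
qed

lemma cdf_attains_level:
  assumes "real_distribution M" "\<And>x. isCont (cdf M) x" "0 < u" "u < 1"
  shows "\<exists>x. cdf M x = u"
proof -
  interpret real_distribution M by fact
  have "eventually (\<lambda>x. cdf M x < u) at_bot"
    using cdf_lim_at_bot \<open>0 < u\<close> by (rule order_tendstoD)
  then obtain a where a: "\<And>x. x \<le> a \<Longrightarrow> cdf M x < u" by (auto simp: eventually_at_bot_linorder)
  have "eventually (\<lambda>x. u < cdf M x) at_top"
    using cdf_lim_at_top_prob \<open>u < 1\<close> by (rule order_tendstoD)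
  then obtain b where b: "\<And>x. b \<le> x \<Longrightarrow> u < cdf M x" by (auto simp: eventually_at_top_linorder)
  have "\<exists>x\<ge>min a b. x \<le> max a b \<and> cdf M x = u"
    by (rule IVT) (use a[of "min a b"] b[of "max a b"] assms(2) in \<open>auto intro: less_imp_le\<close>)
  then show ?thesis by blast
qed

text \<open>\<open>T\<close> below is the monotone map that moves the density \<open>g\<close> to the almost everywhere positive density
  \<open>h\<close>.  The function \<open>slope\<close> is its derivative in the integrated sense of \<open>nn_integral_slope\<close>.\<close>
locale monotone_transport =
  fixes g h :: "real \<Rightarrow> ennreal"
  assumes g_meas [measurable]: "g \<in> borel_measurable borel"
    and h_meas [measurable]: "h \<in> borel_measurable borel"
    and g_int: "(\<integral>\<^sup>+x. g x \<partial>lborel) = 1"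
    and h_int: "(\<integral>\<^sup>+x. h x \<partial>lborel) = 1"
    and h_pos: "AE x in lborel. 0 < h x"
begin

abbreviation "F \<equiv> cdf (density lborel h)"
abbreviation "G \<equiv> cdf (density lborel g)"
abbreviation "T t \<equiv> quantile F (G t)"
abbreviation "slope t \<equiv> g t / h (T t)"

sublocale M: real_distribution "density lborel h"
  by (intro real_distribution.intro prob_spaceI real_distribution_axioms.intro)
     (simp_all add: emeasure_density h_int)

sublocale N: real_distribution "density lborel g"
  by (intro real_distribution.intro prob_spaceI real_distribution_axioms.intro)
     (simp_all add: emeasure_density g_int)

lemma F_cont: "isCont F x" and G_cont: "isCont G x"
  using measure_density_lborel_singleton[OF h_meas] measure_density_lborel_singleton[OF g_meas] by (simp_all add: M.isCont_cdf N.isCont_cdf)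

lemma F_strict_mono: "strict_mono F"
proof (rule strict_monoI)
  fix x y :: real assume xy: "x < y"
  have "measure (density lborel h) {x<..y} \<noteq> 0"
  proof
    assume "measure (density lborel h) {x<..y} = 0"
    then have "emeasure (density lborel h) {x<..y} = 0"
      by (simp add: M.emeasure_eq_measure)
    then have "(\<integral>\<^sup>+z. h z * indicator {x<..y} z \<partial>lborel) = 0"
      by (simp add: emeasure_density)
    then have "AE z in lborel. h z * indicator {x<..y} z = 0"
      by (subst (asm) nn_integral_0_iff_AE) auto
    with h_pos have "AE z in lborel. z \<notin> {x<..y}"
      by eventually_elim (auto simp: indicator_def split: if_splits)
    then have "emeasure lborel {x<..y} = 0"
      by (subst (asm) AE_iff_measurable[where N="{x<..y}"]) auto
    with xy show False by simp
  qed
  then show "F x < F y"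
    using M.cdf_diff_eq[OF xy] by (smt (verit) measure_nonneg)
qed

lemma F_pos: "0 < F x" and F_less_1: "F x < 1"
  using F_strict_mono[THEN strict_monoD, of "x - 1" x] M.cdf_nonneg[of "x - 1"]
    F_strict_mono[THEN strict_monoD, of x "x + 1"] M.cdf_bounded_prob[of "x + 1"] by simp_all

lemma T_eq: "G t = F s \<Longrightarrow> T t = s"
  using quantile_inverse[OF F_strict_mono] by simp

lemma F_T: "0 < G t \<Longrightarrow> G t < 1 \<Longrightarrow> F (T t) = G t"
  using cdf_attains_level[OF M.real_distribution_axioms F_cont, of "G t"] T_eq by metis

text \<open>\<open>G\<close> turns the measure with density \<open>g\<close> into the uniform distribution.  Because \<open>G\<close> may have flat
  pieces, the sublevel set is compared with the half-line ending at its largest element.\<close>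
lemma measure_G_le:
  assumes u: "0 < u" "u < 1"
  shows "measure (density lborel g) {t. G t \<le> u} = u"
proof -
  let ?A = "{t. G t \<le> u}"
  have cont: "continuous_on UNIV G" using G_cont by (simp add: continuous_at_imp_continuous_on)
  have cl: "closed ?A" by (intro closed_Collect_le cont continuous_on_const)
  obtain t0 where t0: "G t0 = u"
    using cdf_attains_level[OF N.real_distribution_axioms G_cont u] by blast
  obtain v where v: "G v = (u + 1) / 2"
    using cdf_attains_level[OF N.real_distribution_axioms G_cont, of "(u + 1) / 2"] u by auto
  have bdd: "bdd_above ?A"
  proof (rule bdd_aboveI)
    fix t assume "t \<in> ?A"
    show "t \<le> v"
    proof (rule ccontr)
      assume "\<not> t \<le> v"
      then have "G v \<le> G t" by (intro N.cdf_nondecreasing) simp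
      with \<open>t \<in> ?A\<close> u show False by (simp add: v)
    qed
  qed
  have "Sup ?A \<in> ?A" using t0 bdd cl by (intro closed_contains_Sup) auto
  moreover have "t0 \<le> Sup ?A" using t0 bdd by (intro cSup_upper) auto
  then have "u \<le> G (Sup ?A)" using N.cdf_nondecreasing[of t0 "Sup ?A"] t0 by simp
  ultimately have "G (Sup ?A) = u" by simp
  have "?A = {..Sup ?A}"
  proof safe
    fix t assume "G t \<le> u" then show "t \<le> Sup ?A" using bdd by (intro cSup_upper) auto
  next
    fix t assume "t \<le> Sup ?A" then show "G t \<le> u"
      using N.cdf_nondecreasing[of t "Sup ?A"] \<open>G (Sup ?A) = u\<close> by simp
  qed
  then have "measure (density lborel g) ?A = G (Sup ?A)" by (simp add: cdf_def)
  with \<open>G (Sup ?A) = u\<close> show ?thesis by simp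
qed

lemma G_meas [measurable]: "G \<in> borel_measurable borel"
  using G_cont by (intro borel_measurable_continuous_onI) (simp add: continuous_at_imp_continuous_on)

lemma T_meas [measurable]: "(\<lambda>t. T t) \<in> borel_measurable borel"
  unfolding quantile_def by measurable

text \<open>The quantile is meaningful only at levels strictly between 0 and 1.  The levels 0 and 1 are
  attained on a null set only, as the limits \<open>u \<rightarrow> 0\<close> and \<open>u \<rightarrow> 1\<close> of the previous lemma show.\<close>
lemma AE_G: "AE t in density lborel g. 0 < G t \<and> G t < 1"
proof -
  have "measure (density lborel g) {t. G t \<le> 0} \<le> 0"
  proof (rule field_le_epsilon)
    fix e :: real assume "0 < e"
    define u where "u = min e (1/2)"
    have "measure (density lborel g) {t. G t \<le> 0} \<le> measure (density lborel g) {t. G t \<le> u}"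
      using \<open>0 < e\<close> by (intro N.finite_measure_mono) (auto simp: u_def)
    also have "\<dots> = u" using \<open>0 < e\<close> by (intro measure_G_le) (auto simp: u_def)
    finally show "measure (density lborel g) {t. G t \<le> 0} \<le> 0 + e" by (simp add: u_def)
  qed
  moreover have "1 \<le> measure (density lborel g) {t. G t < 1}"
  proof (rule field_le_epsilon)
    fix e :: real assume "0 < e"
    define u where "u = max (1 - e) (1/2)"
    have "u = measure (density lborel g) {t. G t \<le> u}"
      using \<open>0 < e\<close> by (intro measure_G_le[symmetric]) (auto simp: u_def)
    also have "\<dots> \<le> measure (density lborel g) {t. G t < 1}"
      using \<open>0 < e\<close> by (intro N.finite_measure_mono) (auto simp: u_def)
    finally show "1 \<le> measure (density lborel g) {t. G t < 1} + e" by (simp add: u_def)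
  qed
  ultimately have "measure (density lborel g) {t. G t \<le> 0} = 0" "measure (density lborel g) {t. G t < 1} = 1"
    using N.prob_le_1[of "{t. G t < 1}"] by (simp_all add: measure_le_0_iff)
  then have "{t. G t \<le> 0} \<in> null_sets (density lborel g)"
    "AE t in density lborel g. t \<in> {t. G t < 1}"
    using N.AE_prob_1[of "{t. G t < 1}"] by (auto simp: null_sets_def N.emeasure_eq_measure)
  from AE_not_in[OF this(1)] this(2) show ?thesis by eventually_elim auto
qed

lemma T_le_iff: "0 < G t \<Longrightarrow> G t < 1 \<Longrightarrow> T t \<le> c \<longleftrightarrow> G t \<le> F c"
  using F_T[of t] strict_mono_less_eq[OF F_strict_mono] by metis

lemma T_less_iff: "0 < G t \<Longrightarrow> G t < 1 \<Longrightarrow> T t < c \<longleftrightarrow> G t < F c"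
  using F_T[of t] strict_mono_less[OF F_strict_mono] by metis

lemma distr_T: "distr (density lborel g) borel (\<lambda>t. T t) = density lborel h"
proof (rule cdf_unique)
  show "real_distribution (distr (density lborel g) borel (\<lambda>t. T t))" by simp
  show "real_distribution (density lborel h)" by unfold_locales
  show "cdf (distr (density lborel g) borel (\<lambda>t. T t)) = F"
  proof
    fix c
    have "cdf (distr (density lborel g) borel (\<lambda>t. T t)) c = measure (density lborel g) {t. T t \<le> c}"
      by (subst cdf_def) (simp add: measure_distr vimage_def)
    also have "\<dots> = measure (density lborel g) {t. G t \<le> F c}"
      using AE_G by (intro N.finite_measure_eq_AE) (auto simp: T_le_iff)
    also have "\<dots> = F c" by (intro measure_G_le F_pos F_less_1)
    finally show "cdf (distr (density lborel g) borel (\<lambda>t. T t)) c = F c" .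
  qed
qed

lemma nn_integral_T:
  assumes [measurable]: "\<phi> \<in> borel_measurable borel"
  shows "(\<integral>\<^sup>+t. g t * \<phi> (T t) \<partial>lborel) = (\<integral>\<^sup>+s. h s * \<phi> s \<partial>lborel)"
proof -
  have "(\<integral>\<^sup>+s. h s * \<phi> s \<partial>lborel) = (\<integral>\<^sup>+s. \<phi> s \<partial>distr (density lborel g) borel (\<lambda>t. T t))"
    unfolding distr_T by (simp add: nn_integral_density)
  also have "\<dots> = (\<integral>\<^sup>+t. g t * \<phi> (T t) \<partial>lborel)"
    by (simp add: nn_integral_distr nn_integral_density)
  finally show ?thesis by simp
qed

lemma h_finite: "AE x in lborel. h x \<noteq> \<infinity>"
  using h_int by (intro nn_integral_noteq_infinite) auto

text \<open>The fundamental theorem of calculus for \<open>T\<close>.  It holds because \<open>T\<close> maps \<open>g\<close> to \<open>h\<close>: integrating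
  \<open>1 / h\<close> over \<open>T a < s < T b\<close> against \<open>h\<close> gives the length of this interval, and pulling the
  integral back along \<open>T\<close> gives the integral of the slope.\<close>
lemma nn_integral_slope:
  assumes ab: "a < b" and a: "0 < G a" "G a < 1" and b: "0 < G b" "G b < 1"
  shows "(\<integral>\<^sup>+t. slope t * indicator {a<..<b} t \<partial>lborel) = ennreal (T b - T a)"
proof -
  have Gab: "G a \<le> G b" using ab by (intro N.cdf_nondecreasing) simp
  have Tab: "T a \<le> T b" using Gab a b T_le_iff[of a "T b"] F_T[of b] by simp
  let ?I = "{T a<..<T b}"
  have eq: "AE t in density lborel g. t \<in> {a<..<b} \<longleftrightarrow> T t \<in> ?I"
  proof -
    let ?A = "{t. G a < G t \<and> G t < G b}"
    have lt: "measure (density lborel g) {t. G t < G b} = G b"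
    proof -
      have "measure (density lborel g) {t. G t < G b} = measure (distr (density lborel g) borel (\<lambda>t. T t)) {..<T b}"
        using AE_G
        by (subst measure_distr) (auto intro!: N.finite_measure_eq_AE measurable_sets_borel[OF T_meas] simp: T_less_iff F_T b)
      also have "\<dots> = F (T b)" unfolding distr_T using measure_density_lborel_singleton[OF h_meas, of "T b"]
        unfolding cdf_def by (subst ivl_disj_un(2)[symmetric], subst M.finite_measure_Union) auto
      finally show ?thesis using F_T b by simp
    qed
    have "{t. G t < G b} - {t. G t \<le> G a} = ?A" by auto
    then have A: "measure (density lborel g) ?A = G b - G a" if "G a < G b"
      using lt measure_G_le[OF a] that
      by (subst (asm) eq_commute) (auto simp: N.finite_measure_Diff subset_eq)
    \<comment> \<open>\<open>?A\<close> may be smaller than the interval from \<open>a\<close> to \<open>b\<close>, because \<open>G\<close> can be constant near the endpoints;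
        both sets have measure \<open>G b - G a\<close>, so they differ by a null set only.\<close>
    have A': "measure (density lborel g) ?A = G b - G a"
    proof (cases "G a < G b")
      case False with Gab have e: "?A = {}" "G b = G a" by auto
      show ?thesis unfolding e(1) by (simp add: e(2))
    qed (fact A)
    have B: "measure (density lborel g) {a<..<b} = G b - G a"
    proof -
      have "{a<..<b} = {a<..b} - {b}" by auto
      then have "measure (density lborel g) {a<..<b} = measure (density lborel g) {a<..b} - measure (density lborel g) {b}"
        using ab by (simp only:) (subst N.finite_measure_Diff, auto)
      then show ?thesis using N.cdf_diff_eq[OF ab] measure_density_lborel_singleton[OF g_meas] by simp
    qed
    have sub: "?A \<subseteq> {a<..<b}"
    proof
      fix t assume "t \<in> ?A"
      then show "t \<in> {a<..<b}"
        using N.cdf_nondecreasing[of t a] N.cdf_nondecreasing[of b t] by force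
    qed
    then have "measure (density lborel g) ({a<..<b} - ?A) = 0"
      using A' B by (subst N.finite_measure_Diff) auto
    then have "AE t in density lborel g. t \<notin> {a<..<b} - ?A"
      by (intro AE_not_in) (auto simp: null_sets_def N.emeasure_eq_measure)
    with AE_G show ?thesis
    proof eventually_elim
      case (elim t)
      then have "T t \<in> ?I \<longleftrightarrow> t \<in> ?A"
        using T_less_iff[of t "T b"] T_le_iff[of t "T a"] F_T[of a] F_T[of b] a b by (auto simp: not_le)
      with elim sub show ?case by auto
    qed
  qed
  have "(\<integral>\<^sup>+t. slope t * indicator {a<..<b} t \<partial>lborel)
      = (\<integral>\<^sup>+t. (inverse (h (T t)) * indicator {a<..<b} t) \<partial>density lborel g)"
    by (subst nn_integral_density) (auto simp: divide_ennreal_def mult.assoc)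
  also have "\<dots> = (\<integral>\<^sup>+t. (inverse (h (T t)) * indicator ?I (T t)) \<partial>density lborel g)"
    using eq by (intro nn_integral_cong_AE) (auto elim!: eventually_mono simp: indicator_def)
  also have "\<dots> = (\<integral>\<^sup>+t. g t * (inverse (h (T t)) * indicator ?I (T t)) \<partial>lborel)"
    by (subst nn_integral_density) auto
  also have "\<dots> = (\<integral>\<^sup>+s. h s * (inverse (h s) * indicator ?I s) \<partial>lborel)"
    by (rule nn_integral_T) auto
  also have "\<dots> = (\<integral>\<^sup>+s. indicator ?I s \<partial>lborel)"
    using h_pos h_finite
    by (intro nn_integral_cong_AE, eventually_elim)
       (simp add: mult.assoc[symmetric] divide_ennreal_def[symmetric] ennreal_divide_self less_top)
  also have "\<dots> = ennreal (T b - T a)" using Tab by simp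
  finally show ?thesis .
qed

text \<open>Change of variables along \<open>z s = (1 - t) T s + t s\<close>.  On the open set \<open>E\<close> where \<open>0 < G < 1\<close>, the map \<open>z\<close> is
  strictly increasing and reaches every real number, and by the previous lemma the integral of
  \<open>t + (1 - t) slope\<close> between two points is the increment of \<open>z\<close>.  So \<open>z\<close> maps the measure with this density on
  \<open>E\<close> to Lebesgue measure, and almost all points with \<open>0 < g\<close> lie in \<open>E\<close>.\<close>
lemma nn_integral_interpolation:
  assumes t: "0 < t" "t < 1" and [measurable]: "\<phi> \<in> borel_measurable borel"
  shows "(\<integral>\<^sup>+s. \<phi> ((1 - t) * T s + t * s) * (ennreal t + ennreal (1 - t) * slope s)
            * indicator {s. 0 < g s} s \<partial>lborel) \<le> (\<integral>\<^sup>+s. \<phi> s \<partial>lborel)"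
proof -
  define E where "E = {s. 0 < G s \<and> G s < 1}"
  define z where "z s = (1 - t) * T s + t * s" for s
  have [measurable]: "E \<in> sets borel" unfolding E_def by measurable
  have [measurable]: "z \<in> borel_measurable borel" unfolding z_def by measurable
  define w where "w s = (ennreal t + ennreal (1 - t) * slope s) * indicator E s" for s
  have [measurable]: "w \<in> borel_measurable borel" unfolding w_def by measurable
  have z_mono: "z a < z b" if "a \<in> E" "b \<in> E" "a < b" for a b
  proof -
    have "T a \<le> T b"
      using that N.cdf_nondecreasing[of a b] T_le_iff[of a "T b"] F_T[of b] by (simp add: E_def)
    then show ?thesis using t \<open>a < b\<close> unfolding z_def
      by (intro add_le_less_mono mult_left_mono) auto
  qed
  have z_surj: "\<exists>a\<in>E. z a = l" for l
  proof -
    \<comment> \<open>Solving \<open>z a = l\<close> directly would require continuity of \<open>T\<close>.  Instead \<open>?x a\<close> is the value that \<open>T a\<close>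
        has to take, and \<open>G a = F (?x a)\<close> expresses that it takes this value.\<close>
    let ?x = "\<lambda>a. (l - t * a) / (1 - t)"
    let ?\<psi> = "\<lambda>a. G a - F (?x a)"
    have c: "isCont ?\<psi> a" for a
      by (rule continuous_diff[OF G_cont])
         (rule isCont_o2[OF _ F_cont], use t in \<open>auto intro!: continuous_intros\<close>)
    have l1: "(G \<longlongrightarrow> 0) at_bot" "(G \<longlongrightarrow> 1) at_top"
      by (rule N.cdf_lim_at_bot) (rule N.cdf_lim_at_top_prob)
    have x1: "filterlim ?x at_top at_bot" "filterlim ?x at_bot at_top"
      using t by real_asymp+
    have l2: "((\<lambda>a. F (?x a)) \<longlongrightarrow> 1) at_bot" "((\<lambda>a. F (?x a)) \<longlongrightarrow> 0) at_top"
      by (rule filterlim_compose[OF M.cdf_lim_at_top_prob x1(1)],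
          rule filterlim_compose[OF M.cdf_lim_at_bot x1(2)])
    have "(?\<psi> \<longlongrightarrow> 0 - 1) at_bot" "(?\<psi> \<longlongrightarrow> 1 - 0) at_top"
      by (intro tendsto_diff l1 l2)+
    then have e: "eventually (\<lambda>a. ?\<psi> a < 0) at_bot" "eventually (\<lambda>a. 0 < ?\<psi> a) at_top"
      using order_tendstoD(2)[of ?\<psi> "0 - 1" at_bot 0] order_tendstoD(1)[of ?\<psi> "1 - 0" at_top 0] by simp_all
    obtain p where p: "\<And>a. a \<le> p \<Longrightarrow> ?\<psi> a < 0"
      using e(1) by (auto simp: eventually_at_bot_linorder)
    obtain q where q: "\<And>a. q \<le> a \<Longrightarrow> 0 < ?\<psi> a"
      using e(2) by (auto simp: eventually_at_top_linorder)
    have "\<exists>a\<ge>min p q. a \<le> max p q \<and> ?\<psi> a = 0"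
      by (rule IVT) (use p[of "min p q"] q[of "max p q"] c in \<open>auto intro: less_imp_le\<close>)
    then obtain a where a: "G a = F (?x a)" by auto
    then have "a \<in> E" using F_pos F_less_1 by (simp add: E_def)
    moreover have "z a = l" using T_eq[OF a] t by (simp add: z_def)
    ultimately show ?thesis by blast
  qed
  have "lborel = distr (density lborel w) borel z"
  proof (rule lborel_eqI)
    fix l u :: real assume "\<And>b. b \<in> Basis \<Longrightarrow> l \<bullet> b \<le> u \<bullet> b"
    then have lu: "l \<le> u" by simp
    obtain a where a: "a \<in> E" "z a = l" using z_surj by blast
    obtain b where b: "b \<in> E" "z b = u" using z_surj by blast
    have pre: "s \<in> {a<..<b} \<longleftrightarrow> z s \<in> {l<..<u} \<and> s \<in> E" for s
    proof
      assume s: "s \<in> {a<..<b}"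
      then have "s \<in> E" using a(1) b(1) N.cdf_nondecreasing[of a s] N.cdf_nondecreasing[of s b]
        by (auto simp: E_def)
      with s a b z_mono show "z s \<in> {l<..<u} \<and> s \<in> E" by auto
    next
      assume s: "z s \<in> {l<..<u} \<and> s \<in> E"
      then show "s \<in> {a<..<b}" using a b z_mono[of s a] z_mono[of b s]
        by (cases s a rule: linorder_cases; cases s b rule: linorder_cases) auto
    qed
    have ab: "a \<le> b" using lu a b z_mono[of b a] by force
    have Tab: "T a \<le> T b" using a b ab
      using N.cdf_nondecreasing[of a b] T_le_iff[of a "T b"] F_T[of b] by (simp add: E_def)
    have "emeasure (distr (density lborel w) borel z) {l<..<u}
        = (\<integral>\<^sup>+s. w s * indicator {l<..<u} (z s) \<partial>lborel)"
      by (simp add: emeasure_distr emeasure_density indicator_vimage[symmetric] indicator_def vimage_def)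
    also have "\<dots> = (\<integral>\<^sup>+s. ennreal t * indicator {a<..<b} s + ennreal (1 - t) * (slope s * indicator {a<..<b} s) \<partial>lborel)"
      using pre by (intro nn_integral_cong) (auto simp: w_def indicator_def)
    also have "\<dots> = ennreal t * ennreal (b - a) + ennreal (1 - t) * (\<integral>\<^sup>+s. slope s * indicator {a<..<b} s \<partial>lborel)"
      using ab by (subst nn_integral_add) (auto simp: nn_integral_cmult)
    also have "(\<integral>\<^sup>+s. slope s * indicator {a<..<b} s \<partial>lborel) = ennreal (T b - T a)"
      using a b ab by (cases "a = b") (auto simp: E_def intro!: nn_integral_slope)
    also have "ennreal t * ennreal (b - a) + ennreal (1 - t) * ennreal (T b - T a)
        = ennreal (t * (b - a) + (1 - t) * (T b - T a))"
      using t ab Tab by (simp add: ennreal_mult)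
    also have "t * (b - a) + (1 - t) * (T b - T a) = u - l"
      using a b by (auto simp: z_def algebra_simps)
    finally show "emeasure (distr (density lborel w) borel z) (box l u) = (\<Prod>b\<in>Basis. (u - l) \<bullet> b)"
      using lu by simp
  qed simp
  then have "(\<integral>\<^sup>+s. \<phi> s \<partial>lborel) = (\<integral>\<^sup>+s. \<phi> s \<partial>distr (density lborel w) borel z)" by simp
  also have "\<dots> = (\<integral>\<^sup>+s. w s * \<phi> (z s) \<partial>lborel)"
    by (simp add: nn_integral_distr nn_integral_density)
  also have "\<dots> \<ge> (\<integral>\<^sup>+s. \<phi> (z s) * (ennreal t + ennreal (1 - t) * slope s) * indicator {s. 0 < g s} s \<partial>lborel)"
  proof (rule nn_integral_mono_AE)
    have "AE s in lborel. 0 < g s \<longrightarrow> s \<in> E"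
      using AE_G by (subst (asm) AE_density) (simp_all add: E_def)
    then show "AE s in lborel. \<phi> (z s) * (ennreal t + ennreal (1 - t) * slope s) * indicator {s. 0 < g s} s
        \<le> w s * \<phi> (z s)"
      by eventually_elim (auto simp: w_def indicator_def mult.commute)
  qed
  finally show ?thesis unfolding z_def .
qed

end

section \<open>Triangular transport on finite products of the line\<close>

lemma ennreal_divide_mult_cancel:
  fixes a b :: ennreal
  assumes "0 < a" "a \<noteq> \<infinity>"
  shows "b / a * a = b"
  using assms ennreal_mult_divide_eq[of a b] by (simp add: divide_ennreal_def mult_ac zero_less_iff_neq_zero)

interpretation lebesgue_product: product_sigma_finite "\<lambda>_::'i. lborel :: real measure"
  by standard

abbreviation lebesgue_PiM :: "'i set \<Rightarrow> ('i \<Rightarrow> real) measure" where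
  "lebesgue_PiM I \<equiv> PiM I (\<lambda>_. lborel)"

text \<open>The map \<open>S\<close> moves \<open>g\<close> to \<open>f\<close>, the \<open>q i\<close> are the diagonal entries of its triangular Jacobian
  matrix, and the last clause is the change of variables along the interpolation between \<open>S\<close> and
  the identity.  It is an inequality because its left-hand side integrates only over the points with \<open>0 < g\<close>.\<close>
definition interpolating_transport ::
  "'i set \<Rightarrow> (('i \<Rightarrow> real) \<Rightarrow> ennreal) \<Rightarrow> (('i \<Rightarrow> real) \<Rightarrow> ennreal) \<Rightarrow>
    (('i \<Rightarrow> real) \<Rightarrow> 'i \<Rightarrow> real) \<Rightarrow> ('i \<Rightarrow> ('i \<Rightarrow> real) \<Rightarrow> ennreal) \<Rightarrow> bool" where
  "interpolating_transport I g f S q \<longleftrightarrow>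
     S \<in> lebesgue_PiM I \<rightarrow>\<^sub>M lebesgue_PiM I \<and>
     (\<forall>i\<in>I. q i \<in> borel_measurable (lebesgue_PiM I)) \<and>
     distr (density (lebesgue_PiM I) g) (lebesgue_PiM I) S = density (lebesgue_PiM I) f \<and>
     (AE y in lebesgue_PiM I. 0 < g y \<longrightarrow> (\<Prod>i\<in>I. q i y) * f (S y) = g y) \<and>
     (\<forall>t \<phi>. 0 < t \<longrightarrow> t < 1 \<longrightarrow> \<phi> \<in> borel_measurable (lebesgue_PiM I) \<longrightarrow>
        (\<integral>\<^sup>+y. \<phi> (\<lambda>i\<in>I. (1 - t) * S y i + t * y i)
             * (\<Prod>i\<in>I. ennreal t + ennreal (1 - t) * q i y) * indicator {y. 0 < g y} y
          \<partial>lebesgue_PiM I) \<le> (\<integral>\<^sup>+z. \<phi> z \<partial>lebesgue_PiM I))"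

lemma interpolating_transport_empty:
  assumes "(\<integral>\<^sup>+x. f x \<partial>lebesgue_PiM {}) = 1" "(\<integral>\<^sup>+x. g x \<partial>lebesgue_PiM {}) = 1"
  shows "interpolating_transport {} g f (\<lambda>y. y) q"
proof -
  have "f (\<lambda>_. undefined) = 1" "g (\<lambda>_. undefined) = 1"
    using assms by (simp_all add: lebesgue_product.nn_integral_empty)
  then have *: "density (lebesgue_PiM {}) g = density (lebesgue_PiM {}) f"
    unfolding PiM_empty by (intro density_cong) (simp_all add: AE_count_space)
  show ?thesis
    unfolding interpolating_transport_def
    using \<open>f _ = 1\<close> \<open>g _ = 1\<close>
    by (auto simp: *[unfolded PiM_empty] distr_id2 PiM_empty nn_integral_count_space_finite AE_count_space restrict_def)
qed

lemma measurable_slice: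
  assumes "f \<in> borel_measurable (lebesgue_PiM (insert k I))" "x \<in> space (lebesgue_PiM I)"
  shows "(\<lambda>s. f (x(k := s))) \<in> borel_measurable borel"
proof -
  have "(\<lambda>s. x(k := s)) \<in> borel \<rightarrow>\<^sub>M lebesgue_PiM (insert k I)"
    using measurable_compose[OF measurable_Pair1'[OF assms(2)] measurable_add_dim[of k I "\<lambda>_. lborel"]] by simp
  from measurable_compose[OF this assms(1)] show ?thesis .
qed

lemma measurable_insert_coordinate [measurable (raw)]:
  assumes "X \<in> N \<rightarrow>\<^sub>M lebesgue_PiM I" "s \<in> borel_measurable N"
  shows "(\<lambda>w. (X w)(k := s w)) \<in> N \<rightarrow>\<^sub>M lebesgue_PiM (insert k I)"
proof -
  have "(\<lambda>w. (X w, s w)) \<in> N \<rightarrow>\<^sub>M lebesgue_PiM I \<Otimes>\<^sub>M lborel" using assms by simp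
  from measurable_compose[OF this measurable_add_dim[of k I "\<lambda>_. lborel"]]
  show ?thesis by simp
qed

lemma measurable_cdf_density:
  fixes p :: "'b \<Rightarrow> real \<Rightarrow> ennreal" and r :: "'b \<Rightarrow> real"
  assumes p: "(\<lambda>(w, s). p w s) \<in> borel_measurable (N \<Otimes>\<^sub>M borel)" and [measurable]: "r \<in> borel_measurable N"
  shows "(\<lambda>w. cdf (density lborel (p w)) (r w)) \<in> borel_measurable N"
proof -
  have [measurable]: "(\<lambda>(w, s). p w s) \<in> borel_measurable (N \<Otimes>\<^sub>M lborel)" using p by simp
  have "(\<lambda>w. enn2real (\<integral>\<^sup>+s. p w s * indicator {..r w} s \<partial>lborel)) \<in> borel_measurable N"
    unfolding indicator_def atMost_iff by measurable
  also have "?this \<longleftrightarrow> (\<lambda>w. cdf (density lborel (p w)) (r w)) \<in> borel_measurable N"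
  proof (rule measurable_cong)
    fix w assume "w \<in> space N"
    then have "p w \<in> borel_measurable borel"
      using measurable_compose[OF measurable_Pair1' p] by simp
    then show "enn2real (\<integral>\<^sup>+s. p w s * indicator {..r w} s \<partial>lborel) = cdf (density lborel (p w)) (r w)"
      by (simp add: cdf_def measure_def emeasure_density)
  qed
  finally show ?thesis .
qed

text \<open>The inductive step of Knothe's construction.  The transport \<open>S\<close> between the marginals on \<open>I\<close> comes from
  the induction hypothesis.  Over each point \<open>y\<close>, the new coordinate is moved by the monotone map
  between the conditional density of \<open>g\<close> at \<open>y\<close> and that of \<open>f\<close> at \<open>S y\<close>.  Each of the three clauses follows
  from Fubini's theorem, the one-dimensional statement on the fibres and the induction
  hypothesis on the base.\<close>
lemma interpolating_transport_insert:
  fixes f g :: "('i \<Rightarrow> real) \<Rightarrow> ennreal"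
  assumes I: "finite I" "k \<notin> I"
    and f [measurable]: "f \<in> borel_measurable (lebesgue_PiM (insert k I))"
    and g [measurable]: "g \<in> borel_measurable (lebesgue_PiM (insert k I))"
    and f_int: "(\<integral>\<^sup>+x. f x \<partial>lebesgue_PiM (insert k I)) = 1"
    and g_int: "(\<integral>\<^sup>+x. g x \<partial>lebesgue_PiM (insert k I)) = 1"
    and f_pos: "AE x in lebesgue_PiM (insert k I). 0 < f x"
    and IH: "\<And>f g. f \<in> borel_measurable (lebesgue_PiM I) \<Longrightarrow> g \<in> borel_measurable (lebesgue_PiM I)
      \<Longrightarrow> (\<integral>\<^sup>+x. f x \<partial>lebesgue_PiM I) = 1 \<Longrightarrow> (\<integral>\<^sup>+x. g x \<partial>lebesgue_PiM I) = 1
      \<Longrightarrow> AE x in lebesgue_PiM I. 0 < f x \<Longrightarrow> \<exists>S q. interpolating_transport I g f S q"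
  shows "\<exists>S q. interpolating_transport (insert k I) g f S q"
proof -
  let ?L = "lebesgue_PiM I" and ?L' = "lebesgue_PiM (insert k I)"
  note insert_int = lebesgue_product.product_nn_integral_insert[OF I]
  define fI where "fI x = (\<integral>\<^sup>+s. f (x(k := s)) \<partial>lborel)" for x
  define gI where "gI x = (\<integral>\<^sup>+s. g (x(k := s)) \<partial>lborel)" for x
  have [measurable]: "fI \<in> borel_measurable ?L" "gI \<in> borel_measurable ?L"
    unfolding fI_def gI_def by measurable
  have fI_int: "(\<integral>\<^sup>+x. fI x \<partial>?L) = 1" and gI_int: "(\<integral>\<^sup>+x. gI x \<partial>?L) = 1"
    using f_int g_int by (simp_all add: insert_int fI_def gI_def)
  have f_pos': "AE x in ?L. AE s in lborel. 0 < f (x(k := s))"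
  proof -
    have "(\<integral>\<^sup>+x. indicator {x. f x = 0} x \<partial>?L') = (\<integral>\<^sup>+x. 0 \<partial>?L')"
      using f_pos by (intro nn_integral_cong_AE) (auto elim!: eventually_mono simp: indicator_def)
    also have "(\<integral>\<^sup>+x. indicator {x. f x = 0} x \<partial>?L')
        = (\<integral>\<^sup>+x. \<integral>\<^sup>+s. indicator {s. f (x(k := s)) = 0} s \<partial>lborel \<partial>?L)"
      by (subst insert_int) (auto intro!: nn_integral_cong simp: indicator_def)
    finally have "(\<integral>\<^sup>+x. \<integral>\<^sup>+s. indicator {s. f (x(k := s)) = 0} s \<partial>lborel \<partial>?L) = 0"
      by simp
    moreover have "(\<lambda>x. \<integral>\<^sup>+s. indicator {s. f (x(k := s)) = 0} s \<partial>lborel) \<in> borel_measurable ?L"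
      unfolding indicator_def by simp
    ultimately have "AE x in ?L. (\<integral>\<^sup>+s. indicator {s. f (x(k := s)) = 0} s \<partial>lborel) = 0"
      using nn_integral_0_iff_AE by blast
    with AE_space show ?thesis
    proof eventually_elim
      case (elim x)
      have [measurable]: "(\<lambda>s. f (x(k := s))) \<in> borel_measurable borel"
        by (rule measurable_slice[OF f elim(1)])
      from elim(2) have "AE s in lborel. indicator {s. f (x(k := s)) = 0} s = (0::ennreal)"
        by (subst (asm) nn_integral_0_iff_AE) simp_all
      then show ?case by eventually_elim (auto simp: indicator_def zero_less_iff_neq_zero split: if_splits)
    qed
  qed
  have fI_pos: "AE x in ?L. 0 < fI x"
    using f_pos' AE_space
  proof eventually_elim
    case (elim x)
    have [measurable]: "(\<lambda>s. f (x(k := s))) \<in> borel_measurable borel"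
      by (rule measurable_slice[OF f elim(2)])
    have "fI x \<noteq> 0"
    proof
      assume "fI x = 0"
      then have "AE s in lborel. f (x(k := s)) = 0"
        unfolding fI_def by (subst (asm) nn_integral_0_iff_AE) simp_all
      with elim(1) have "AE s in lborel :: real measure. False" by eventually_elim auto
      then show False by (simp add: trivial_limit_def[symmetric] ae_filter_eq_bot_iff)
    qed
    then show ?case by (simp add: zero_less_iff_neq_zero)
  qed
  obtain S q where "interpolating_transport I gI fI S q"
    using IH[OF _ _ fI_int gI_int fI_pos] by auto
  then have S [measurable]: "S \<in> ?L \<rightarrow>\<^sub>M ?L"
    and q [measurable]: "\<And>i. i \<in> I \<Longrightarrow> q i \<in> borel_measurable ?L"
    and distr_S: "distr (density ?L gI) ?L S = density ?L fI"
    and jac: "AE y in ?L. 0 < gI y \<longrightarrow> (\<Prod>i\<in>I. q i y) * fI (S y) = gI y"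
    and interp: "\<And>t \<phi>. 0 < t \<Longrightarrow> t < 1 \<Longrightarrow> \<phi> \<in> borel_measurable ?L \<Longrightarrow>
        (\<integral>\<^sup>+y. \<phi> (\<lambda>i\<in>I. (1 - t) * S y i + t * y i)
             * (\<Prod>i\<in>I. ennreal t + ennreal (1 - t) * q i y) * indicator {y. 0 < gI y} y
          \<partial>?L) \<le> (\<integral>\<^sup>+z. \<phi> z \<partial>?L)"
    by (auto simp: interpolating_transport_def)

  define h where "h y s = f ((S y)(k := s)) / fI (S y)" for y s
  define p where "p y s = g (y(k := s)) / gI y" for y s
  \<comment> \<open>At a good point both conditional densities exist and the one of \<open>f\<close> is positive.  The properties
      of \<open>f\<close> hold almost everywhere; they hold at \<open>S y\<close> for almost every \<open>y\<close> since \<open>S\<close> pushes \<open>gI\<close>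
      forward to \<open>fI\<close>.\<close>
  define good where "good y \<longleftrightarrow> y \<in> space ?L \<and> 0 < gI y \<and> gI y \<noteq> \<infinity> \<and> 0 < fI (S y) \<and> fI (S y) \<noteq> \<infinity> \<and>
    (AE s in lborel. 0 < f ((S y)(k := s)))" for y
  have AE_good: "AE y in ?L. 0 < gI y \<longrightarrow> good y"
  proof -
    have "AE x in ?L. 0 < fI x \<and> fI x \<noteq> \<infinity> \<and> (AE s in lborel. 0 < f (x(k := s)))"
      using fI_pos f_pos' nn_integral_noteq_infinite[of fI ?L] fI_int by auto
    then have "AE x in density ?L fI. 0 < fI x \<and> fI x \<noteq> \<infinity> \<and> (AE s in lborel. 0 < f (x(k := s)))"
      by (subst AE_density) auto
    then have "AE y in density ?L gI. 0 < fI (S y) \<and> fI (S y) \<noteq> \<infinity> \<and> (AE s in lborel. 0 < f ((S y)(k := s)))"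
      unfolding distr_S[symmetric] by (rule AE_distrD[rotated]) simp
    then have "AE y in ?L. 0 < gI y \<longrightarrow> 0 < fI (S y) \<and> fI (S y) \<noteq> \<infinity> \<and> (AE s in lborel. 0 < f ((S y)(k := s)))"
      by (subst (asm) AE_density) auto
    moreover have "AE y in ?L. gI y \<noteq> \<infinity>"
      using gI_int by (intro nn_integral_noteq_infinite) auto
    ultimately show ?thesis using AE_space
      by eventually_elim (auto simp: good_def)
  qed
  have slices: "(\<lambda>s. f ((S y)(k := s))) \<in> borel_measurable borel"
      "(\<lambda>s. g (y(k := s))) \<in> borel_measurable borel" if "y \<in> space ?L" for y
    using that measurable_slice[OF f measurable_space[OF S]] measurable_slice[OF g] by auto
  have transport: "monotone_transport (p y) (h y)" if "good y" for y
  proof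
    have [measurable]: "(\<lambda>s. f ((S y)(k := s))) \<in> borel_measurable borel"
      "(\<lambda>s. g (y(k := s))) \<in> borel_measurable borel"
      using that slices by (auto simp: good_def)
    show "p y \<in> borel_measurable borel" "h y \<in> borel_measurable borel"
      unfolding p_def h_def by measurable
    show "(\<integral>\<^sup>+s. p y s \<partial>lborel) = 1" "(\<integral>\<^sup>+s. h y s \<partial>lborel) = 1"
      unfolding p_def h_def using that
      by (simp_all add: nn_integral_divide gI_def[symmetric] fI_def[symmetric] good_def
          ennreal_divide_self less_top zero_less_iff_neq_zero)
    show "AE s in lborel. 0 < h y s"
      using that by (auto simp: good_def h_def ennreal_zero_less_divide less_top elim!: eventually_mono)
  qed
  define \<sigma> where "\<sigma> y s = quantile (cdf (density lborel (h y))) (cdf (density lborel (p y)) s)" for y s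
  have \<sigma> [measurable]: "(\<lambda>w. \<sigma> (fst w) (snd w)) \<in> borel_measurable (?L \<Otimes>\<^sub>M borel)"
  proof -
    have [measurable]: "(\<lambda>w. cdf (density lborel (h (fst w))) r) \<in> borel_measurable (?L \<Otimes>\<^sub>M borel)" for r
      unfolding h_def by (rule measurable_cdf_density) measurable
    have [measurable]: "(\<lambda>w. cdf (density lborel (p (fst w))) (snd w)) \<in> borel_measurable (?L \<Otimes>\<^sub>M borel)"
      unfolding p_def by (rule measurable_cdf_density) measurable
    show ?thesis unfolding \<sigma>_def quantile_def by measurable
  qed
  define r where "r y s = p y s / h y (\<sigma> y s)" for y s
  have \<sigma>' [measurable (raw)]: "(\<lambda>w. \<sigma> (Y w) (s w)) \<in> borel_measurable N"
    if "Y \<in> N \<rightarrow>\<^sub>M ?L" "s \<in> borel_measurable N" for Y s and N :: "'c measure"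
    using measurable_compose[OF measurable_Pair[OF that] \<sigma>] by simp
  have r' [measurable (raw)]: "(\<lambda>w. r (Y w) (s w)) \<in> borel_measurable N"
    if [measurable]: "Y \<in> N \<rightarrow>\<^sub>M ?L" "s \<in> borel_measurable N" for Y s and N :: "'c measure"
    unfolding r_def p_def h_def by measurable
  have res [measurable]: "(\<lambda>w. restrict w I) \<in> ?L' \<rightarrow>\<^sub>M ?L"
    by (rule measurable_restrict_subset) auto
  have comp [measurable]: "(\<lambda>w. w k) \<in> borel_measurable ?L'"
    using measurable_component_singleton[of k "insert k I" "\<lambda>_. lborel"] by simp
  define S' where "S' w = (S (restrict w I))(k := \<sigma> (restrict w I) (w k))" for w
  define q' where "q' i w = (if i = k then r (restrict w I) (w k) else q i (restrict w I))" for i w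
  have upd: "restrict (y(k := s)) I = y" if "y \<in> space ?L" for y s
    using that I(2) by (auto simp: space_PiM restrict_def PiE_def extensional_def fun_eq_iff)
  have S'_upd: "S' (y(k := s)) = (S y)(k := \<sigma> y s)" if "y \<in> space ?L" for y s
    using upd[OF that] by (simp add: S'_def)
  have S'_meas [measurable]: "S' \<in> ?L' \<rightarrow>\<^sub>M ?L'"
  proof -
    have "(\<lambda>w. (S (restrict w I), \<sigma> (restrict w I) (w k))) \<in> ?L' \<rightarrow>\<^sub>M ?L \<Otimes>\<^sub>M lborel" by measurable
    from measurable_compose[OF this measurable_add_dim[of k I "\<lambda>_. lborel"]]
    show ?thesis by (simp add: S'_def[abs_def])
  qed
  have q'_meas [measurable]: "q' i \<in> borel_measurable ?L'" if "i \<in> insert k I" for i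
  proof (cases "i = k")
    case True
    then have "q' i = (\<lambda>w. r (restrict w I) (w k))" by (simp add: q'_def fun_eq_iff)
    then show ?thesis by simp
  next
    case False
    with that have "i \<in> I" by simp
    from False have "q' i = (\<lambda>w. q i (restrict w I))" by (simp add: q'_def fun_eq_iff)
    with measurable_compose[OF res q[OF \<open>i \<in> I\<close>]] show ?thesis by simp
  qed
  have q'_prod: "(\<Prod>i\<in>insert k I. F (q' i (y(k := s)))) = F (r y s) * (\<Prod>i\<in>I. F (q i y))"
    if "y \<in> space ?L" for y s and F :: "ennreal \<Rightarrow> ennreal"
  proof -
    have "(\<Prod>i\<in>I. F (q' i (y(k := s)))) = (\<Prod>i\<in>I. F (q i y))"
      using I(2) upd[OF that] by (intro prod.cong) (auto simp: q'_def)
    then show ?thesis using I upd[OF that] by (simp add: q'_def)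
  qed
  have g_zero: "AE s in lborel. g (y(k := s)) = 0" if "y \<in> space ?L" "\<not> 0 < gI y" for y
    using that slices[OF that(1)] unfolding gI_def by (simp add: nn_integral_0_iff_AE)

  have "distr (density ?L' g) ?L' S' = density ?L' f"
  proof (rule measure_eqI)
    fix A assume "A \<in> sets (distr (density ?L' g) ?L' S')"
    then have A [measurable]: "A \<in> sets ?L'" by simp
    let ?\<psi> = "\<lambda>x s. indicator A (x(k := s)) :: ennreal"
    have "emeasure (distr (density ?L' g) ?L' S') A = (\<integral>\<^sup>+w. g w * indicator A (S' w) \<partial>?L')"
    proof -
      have "emeasure (distr (density ?L' g) ?L' S') A = (\<integral>\<^sup>+w. indicator A w \<partial>distr (density ?L' g) ?L' S')"
        by simp
      also have "\<dots> = (\<integral>\<^sup>+w. indicator A (S' w) \<partial>density ?L' g)"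
        by (subst nn_integral_distr) auto
      also have "\<dots> = (\<integral>\<^sup>+w. g w * indicator A (S' w) \<partial>?L')"
        by (subst nn_integral_density) auto
      finally show ?thesis .
    qed
    also have "\<dots> = (\<integral>\<^sup>+y. \<integral>\<^sup>+s. g (y(k := s)) * ?\<psi> (S y) (\<sigma> y s) \<partial>lborel \<partial>?L)"
      by (subst insert_int) (auto intro!: nn_integral_cong simp: S'_upd)
    also have "\<dots> = (\<integral>\<^sup>+y. gI y * (\<integral>\<^sup>+s. h y s * ?\<psi> (S y) s \<partial>lborel) \<partial>?L)"
    proof (rule nn_integral_cong_AE)
      show "AE y in ?L. (\<integral>\<^sup>+s. g (y(k := s)) * ?\<psi> (S y) (\<sigma> y s) \<partial>lborel)
          = gI y * (\<integral>\<^sup>+s. h y s * ?\<psi> (S y) s \<partial>lborel)"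
        using AE_good AE_space
      proof eventually_elim
        case (elim y)
        have [measurable]: "(\<lambda>s. f ((S y)(k := s))) \<in> borel_measurable borel"
          "(\<lambda>s. g (y(k := s))) \<in> borel_measurable borel"
          using elim slices by auto
        have Sy [measurable]: "S y \<in> space ?L" using measurable_space[OF S] elim by blast
        have [measurable]: "?\<psi> (S y) \<in> borel_measurable borel"
          by (rule measurable_slice[OF _ Sy]) simp
        show ?case
        proof (cases "0 < gI y")
          case True
          with elim have gd: "good y" by simp
          interpret monotone_transport "p y" "h y" by (rule transport[OF gd])
          have "(\<integral>\<^sup>+s. g (y(k := s)) * ?\<psi> (S y) (\<sigma> y s) \<partial>lborel)
              = (\<integral>\<^sup>+s. gI y * (p y s * ?\<psi> (S y) (\<sigma> y s)) \<partial>lborel)"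
            using gd by (intro nn_integral_cong)
              (simp add: p_def good_def mult.assoc[symmetric] mult.commute[of "gI y"] ennreal_divide_mult_cancel)
          also have "\<dots> = gI y * (\<integral>\<^sup>+s. p y s * ?\<psi> (S y) (\<sigma> y s) \<partial>lborel)"
            unfolding \<sigma>_def by (subst nn_integral_cmult) auto
          also have "(\<integral>\<^sup>+s. p y s * ?\<psi> (S y) (\<sigma> y s) \<partial>lborel) = (\<integral>\<^sup>+s. h y s * ?\<psi> (S y) s \<partial>lborel)"
            unfolding \<sigma>_def by (rule nn_integral_T) simp
          finally show ?thesis .
        next
          case False
          have "(\<integral>\<^sup>+s. g (y(k := s)) * ?\<psi> (S y) (\<sigma> y s) \<partial>lborel) = (\<integral>\<^sup>+s. 0 \<partial>(lborel :: real measure))"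
            using g_zero[OF elim(2) False] by (intro nn_integral_cong_AE) auto
          with False show ?thesis by simp
        qed
      qed
    qed
    also have "\<dots> = (\<integral>\<^sup>+y. (\<integral>\<^sup>+s. f (y(k := s)) / fI y * ?\<psi> y s \<partial>lborel) \<partial>distr (density ?L gI) ?L S)"
      unfolding h_def by (simp add: nn_integral_distr nn_integral_density)
    also have "\<dots> = (\<integral>\<^sup>+y. fI y * (\<integral>\<^sup>+s. f (y(k := s)) / fI y * ?\<psi> y s \<partial>lborel) \<partial>?L)"
      unfolding distr_S by (simp add: nn_integral_density)
    also have "\<dots> = (\<integral>\<^sup>+y. \<integral>\<^sup>+s. f (y(k := s)) * ?\<psi> y s \<partial>lborel \<partial>?L)"
    proof (rule nn_integral_cong_AE)
      have "AE y in ?L. fI y \<noteq> \<infinity>"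
        using fI_int by (intro nn_integral_noteq_infinite) auto
      then show "AE y in ?L. fI y * (\<integral>\<^sup>+s. f (y(k := s)) / fI y * ?\<psi> y s \<partial>lborel)
          = (\<integral>\<^sup>+s. f (y(k := s)) * ?\<psi> y s \<partial>lborel)"
        using fI_pos AE_space
      proof eventually_elim
        case (elim y)
        have [measurable]: "(\<lambda>s. f (y(k := s))) \<in> borel_measurable borel" "?\<psi> y \<in> borel_measurable borel"
          using elim by (auto intro!: measurable_slice)
        have "fI y * (\<integral>\<^sup>+s. f (y(k := s)) / fI y * ?\<psi> y s \<partial>lborel)
            = (\<integral>\<^sup>+s. fI y * (f (y(k := s)) / fI y * ?\<psi> y s) \<partial>lborel)"
          by (subst nn_integral_cmult) auto
        also have "\<dots> = (\<integral>\<^sup>+s. f (y(k := s)) * ?\<psi> y s \<partial>lborel)"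
          using elim by (intro nn_integral_cong)
            (simp add: mult.assoc[symmetric] mult.commute[of "fI y"] ennreal_divide_mult_cancel)
        finally show ?case .
      qed
    qed
    also have "\<dots> = emeasure (density ?L' f) A"
      by (subst emeasure_density) (simp_all add: insert_int)
    finally show "emeasure (distr (density ?L' g) ?L' S') A = emeasure (density ?L' f) A" .
  qed simp
  moreover have "AE w in ?L'. 0 < g w \<longrightarrow> (\<Prod>i\<in>insert k I. q' i w) * f (S' w) = g w"
  proof -
    define J where "J w = (\<Prod>i\<in>insert k I. q' i w) * f (S' w)" for w
    have J [measurable]: "J \<in> borel_measurable ?L'"
      unfolding J_def by (intro borel_measurable_times_ennreal borel_measurable_prod_ennreal) (use q'_meas in auto)
    have "AE y in ?L. AE s in lborel. 0 < g (y(k := s)) \<longrightarrow> J (y(k := s)) = g (y(k := s))"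
      using AE_good jac AE_space
    proof eventually_elim
      case (elim y)
      show ?case
      proof (cases "0 < gI y")
        case False
        from g_zero[OF elim(3) this] show ?thesis by eventually_elim simp
      next
        case True
        with elim have gd: "good y" by simp
        interpret monotone_transport "p y" "h y" by (rule transport[OF gd])
        have "AE x in distr (density lborel (p y)) borel (\<lambda>s. T s). 0 < h y x \<and> h y x \<noteq> \<infinity>"
          using h_pos h_finite unfolding distr_T by (subst AE_density) auto
        then have "AE s in density lborel (p y). 0 < h y (\<sigma> y s) \<and> h y (\<sigma> y s) \<noteq> \<infinity>"
          unfolding \<sigma>_def by (rule AE_distrD[rotated]) simp
        then have "AE s in lborel. 0 < p y s \<longrightarrow> 0 < h y (\<sigma> y s) \<and> h y (\<sigma> y s) \<noteq> \<infinity>"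
          by (subst (asm) AE_density) auto
        then show ?thesis
        proof (eventually_elim, intro impI)
          fix s
          assume *: "0 < p y s \<longrightarrow> 0 < h y (\<sigma> y s) \<and> h y (\<sigma> y s) \<noteq> \<infinity>" and "0 < g (y(k := s))"
          then have "0 < p y s"
            using gd by (simp add: p_def good_def ennreal_zero_less_divide less_top)
          with * have hs: "0 < h y (\<sigma> y s)" "h y (\<sigma> y s) \<noteq> \<infinity>" by auto
          let ?P = "\<Prod>i\<in>I. q i y" and ?f = "f ((S y)(k := \<sigma> y s))"
          have P: "?P * fI (S y) = gI y" using elim True by simp
          have f_eq: "?f = h y (\<sigma> y s) * fI (S y)"
            using gd by (simp add: h_def good_def ennreal_divide_mult_cancel)
          have "J (y(k := s)) = r y s * ?P * ?f"
            using q'_prod[OF elim(3), of "\<lambda>x. x"] S'_upd[OF elim(3)] by (simp add: J_def)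
          also have "\<dots> = (r y s * h y (\<sigma> y s)) * (?P * fI (S y))"
            unfolding f_eq by (simp add: ac_simps)
          also have "r y s * h y (\<sigma> y s) = p y s"
            using hs by (simp add: r_def ennreal_divide_mult_cancel)
          also have "p y s * (?P * fI (S y)) = g (y(k := s))"
            unfolding P using gd by (simp add: p_def good_def ennreal_divide_mult_cancel)
          finally show "J (y(k := s)) = g (y(k := s))" .
        qed
      qed
    qed
    then have zero: "AE y in ?L. (\<integral>\<^sup>+s. indicator {w. 0 < g w \<and> (J w < g w \<or> g w < J w)} (y(k := s)) \<partial>lborel) = 0"
    proof eventually_elim
      case (elim y)
      then have "(\<integral>\<^sup>+s. indicator {w. 0 < g w \<and> (J w < g w \<or> g w < J w)} (y(k := s)) \<partial>lborel) = (\<integral>\<^sup>+s. 0 \<partial>(lborel :: real measure))"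
        by (intro nn_integral_cong_AE) (auto elim!: eventually_mono simp: indicator_def)
      then show ?case by simp
    qed
    have meas: "(\<lambda>w. indicator {w. 0 < g w \<and> (J w < g w \<or> g w < J w)} w :: ennreal) \<in> borel_measurable ?L'"
      unfolding indicator_def mem_Collect_eq by measurable
    have "(\<integral>\<^sup>+w. indicator {w. 0 < g w \<and> (J w < g w \<or> g w < J w)} w \<partial>?L') = (\<integral>\<^sup>+y. 0 \<partial>?L)"
      unfolding insert_int[OF meas] using zero by (rule nn_integral_cong_AE)
    then have "AE w in ?L'. indicator {w. 0 < g w \<and> (J w < g w \<or> g w < J w)} w = (0 :: ennreal)"
      using nn_integral_0_iff_AE[OF meas] by simp
    then show ?thesis by eventually_elim (auto simp: J_def[symmetric] indicator_def not_less intro: antisym split: if_splits)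
  qed
  moreover have "(\<integral>\<^sup>+w. \<phi> (\<lambda>i\<in>insert k I. (1 - t) * S' w i + t * w i)
             * (\<Prod>i\<in>insert k I. ennreal t + ennreal (1 - t) * q' i w) * indicator {y. 0 < g y} w
          \<partial>?L') \<le> (\<integral>\<^sup>+z. \<phi> z \<partial>?L')" (is "integral\<^sup>N _ ?G \<le> _")
    if t: "0 < t" "t < 1" and \<phi> [measurable]: "\<phi> \<in> borel_measurable ?L'" for t \<phi>
  proof -
    let ?j = "\<lambda>x. ennreal t + ennreal (1 - t) * x"
    let ?z = "\<lambda>y. \<lambda>i\<in>I. (1 - t) * S y i + t * y i"
    have [measurable]: "(\<lambda>w. \<lambda>i\<in>insert k I. (1 - t) * S' w i + t * w i) \<in> ?L' \<rightarrow>\<^sub>M ?L'"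
    proof (rule measurable_restrict)
      fix i assume i: "i \<in> insert k I"
      have [measurable]: "(\<lambda>w. w i) \<in> borel_measurable ?L'"
        using measurable_component_singleton[OF i, of "\<lambda>_. lborel :: real measure"] by simp
      have [measurable]: "(\<lambda>w. S' w i) \<in> borel_measurable ?L'"
        using measurable_compose[OF S'_meas \<open>(\<lambda>w. w i) \<in> borel_measurable ?L'\<close>] by simp
      have "(\<lambda>w. (1 - t) * S' w i + t * w i) \<in> borel_measurable ?L'" by measurable
      then show "(\<lambda>w. (1 - t) * S' w i + t * w i) \<in> ?L' \<rightarrow>\<^sub>M lborel" by simp
    qed
    have G [measurable]: "?G \<in> borel_measurable ?L'"
      by (intro borel_measurable_times_ennreal borel_measurable_prod_ennreal)
        (use q'_meas in \<open>auto simp: indicator_def\<close>)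
    have "integral\<^sup>N ?L' ?G = (\<integral>\<^sup>+y. \<integral>\<^sup>+s. ?G (y(k := s)) \<partial>lborel \<partial>?L)"
      by (rule insert_int) (rule G)
    also have "\<dots> \<le> (\<integral>\<^sup>+y. (\<integral>\<^sup>+s. \<phi> ((?z y)(k := s)) \<partial>lborel) * (\<Prod>i\<in>I. ?j (q i y)) * indicator {y. 0 < gI y} y \<partial>?L)"
    proof (rule nn_integral_mono_AE)
      show "AE y in ?L. (\<integral>\<^sup>+s. ?G (y(k := s)) \<partial>lborel)
          \<le> (\<integral>\<^sup>+s. \<phi> ((?z y)(k := s)) \<partial>lborel) * (\<Prod>i\<in>I. ?j (q i y)) * indicator {y. 0 < gI y} y"
        using AE_good AE_space
      proof eventually_elim
        case (elim y)
        show ?case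
        proof (cases "0 < gI y")
          case False
          have "(\<integral>\<^sup>+s. ?G (y(k := s)) \<partial>lborel) = (\<integral>\<^sup>+s. 0 \<partial>(lborel :: real measure))"
            using g_zero[OF elim(2) False] by (intro nn_integral_cong_AE) (auto elim!: eventually_mono)
          then show ?thesis by simp
        next
          case True
          with elim have gd: "good y" by simp
          interpret monotone_transport "p y" "h y" by (rule transport[OF gd])
          have zy: "?z y \<in> space ?L" by (auto simp: space_PiM)
          have [measurable]: "(\<lambda>s. \<phi> ((?z y)(k := s))) \<in> borel_measurable borel"
            by (rule measurable_slice[OF \<phi> zy])
          have G_eq: "?G (y(k := s)) = (\<Prod>i\<in>I. ?j (q i y)) *
            (\<phi> ((?z y)(k := (1 - t) * \<sigma> y s + t * s)) * ?j (r y s) * indicator {s. 0 < p y s} s)" for s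
          proof -
            have "(\<lambda>i\<in>insert k I. (1 - t) * S' (y(k := s)) i + t * (y(k := s)) i)
                = (?z y)(k := (1 - t) * \<sigma> y s + t * s)"
              using I(2) by (auto simp: S'_upd[OF elim(2)] fun_eq_iff)
            moreover have "0 < g (y(k := s)) \<longleftrightarrow> 0 < p y s"
              using gd by (auto simp: p_def good_def ennreal_zero_less_divide less_top)
            ultimately show ?thesis
              using q'_prod[OF elim(2), of ?j] by (simp add: indicator_def mult_ac)
          qed
          have "(\<integral>\<^sup>+s. ?G (y(k := s)) \<partial>lborel) = (\<Prod>i\<in>I. ?j (q i y)) *
            (\<integral>\<^sup>+s. \<phi> ((?z y)(k := (1 - t) * \<sigma> y s + t * s)) * ?j (r y s) * indicator {s. 0 < p y s} s \<partial>lborel)"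
            unfolding G_eq \<sigma>_def r_def by (rule nn_integral_cmult) (simp add: indicator_def)
          also have "\<dots> \<le> (\<Prod>i\<in>I. ?j (q i y)) * (\<integral>\<^sup>+s. \<phi> ((?z y)(k := s)) \<partial>lborel)"
            unfolding \<sigma>_def r_def by (intro mult_left_mono nn_integral_interpolation[OF t]) auto
          finally show ?thesis using True by (simp add: mult_ac)
        qed
      qed
    qed
    also have "\<dots> \<le> (\<integral>\<^sup>+z. (\<integral>\<^sup>+s. \<phi> (z(k := s)) \<partial>lborel) \<partial>?L)"
      by (rule interp[OF t, of "\<lambda>z. \<integral>\<^sup>+s. \<phi> (z(k := s)) \<partial>lborel"]) measurable
    also have "\<dots> = (\<integral>\<^sup>+z. \<phi> z \<partial>?L')" by (simp add: insert_int)
    finally show ?thesis .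
  qed
  ultimately have "interpolating_transport (insert k I) g f S' q'"
    using S'_meas q'_meas unfolding interpolating_transport_def by blast
  then show ?thesis by blast
qed

theorem interpolating_transport_exists:
  assumes "finite I"
    and "f \<in> borel_measurable (lebesgue_PiM I)" "g \<in> borel_measurable (lebesgue_PiM I)"
    and "(\<integral>\<^sup>+x. f x \<partial>lebesgue_PiM I) = 1" "(\<integral>\<^sup>+x. g x \<partial>lebesgue_PiM I) = 1"
    and "AE x in lebesgue_PiM I. 0 < f x"
  shows "\<exists>S q. interpolating_transport I g f S q"
  using assms
proof (induction I arbitrary: f g rule: finite_induct)
  case empty
  then show ?case using interpolating_transport_empty by blast
next
  case (insert k I)
  show ?case
    by (rule interpolating_transport_insert[OF insert.hyps insert.prems(1-5) insert.IH])
qed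

section \<open>Triangular transport in Euclidean space\<close>

text \<open>Lebesgue measure on a Euclidean space is the image of the product measure on the coordinates with respect
  to \<open>Basis\<close>, and passing to coordinates is linear, so the transport and the interpolation carry over.\<close>
theorem interpolating_transport_euclidean:
  fixes f g :: "'a :: euclidean_space \<Rightarrow> ennreal"
  assumes f [measurable]: "f \<in> borel_measurable borel" and g [measurable]: "g \<in> borel_measurable borel"
    and "(\<integral>\<^sup>+x. f x \<partial>lborel) = 1" "(\<integral>\<^sup>+x. g x \<partial>lborel) = 1" and pos: "\<And>x. 0 < f x"
  obtains S :: "'a \<Rightarrow> 'a" and q :: "'a \<Rightarrow> 'a \<Rightarrow> ennreal"
  where "S \<in> borel \<rightarrow>\<^sub>M borel"
    and "\<And>b. b \<in> Basis \<Longrightarrow> q b \<in> borel_measurable borel"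
    and "distr (density lborel g) borel S = density lborel f"
    and "AE y in lborel. 0 < g y \<longrightarrow> (\<Prod>b\<in>Basis. q b y) * f (S y) = g y"
    and "\<And>t \<phi>. 0 < t \<Longrightarrow> t < 1 \<Longrightarrow> \<phi> \<in> borel_measurable borel \<Longrightarrow>
      (\<integral>\<^sup>+y. \<phi> ((1 - t) *\<^sub>R S y + t *\<^sub>R y) * (\<Prod>b\<in>Basis. ennreal t + ennreal (1 - t) * q b y)
          * indicator {y. 0 < g y} y \<partial>lborel) \<le> (\<integral>\<^sup>+z. \<phi> z \<partial>lborel)"
proof -
  let ?L = "lebesgue_PiM (Basis :: 'a set)"
  define e :: "('a \<Rightarrow> real) \<Rightarrow> 'a" where "e w = (\<Sum>b\<in>Basis. w b *\<^sub>R b)" for w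
  define d :: "'a \<Rightarrow> 'a \<Rightarrow> real" where "d y = (\<lambda>b\<in>Basis. y \<bullet> b)" for y
  have e [measurable]: "e \<in> ?L \<rightarrow>\<^sub>M borel" unfolding e_def by measurable
  have d [measurable]: "d \<in> borel \<rightarrow>\<^sub>M ?L" unfolding d_def by (rule measurable_restrict) simp
  have lborel: "lborel = distr ?L borel e" unfolding e_def by (rule lborel_eq)
  have ed: "e (d y) = y" for y
    by (simp add: e_def d_def euclidean_representation)
  have de: "d (e w) = w" if "w \<in> space ?L" for w
    using that by (auto simp: d_def e_def space_PiM PiE_def extensional_def inner_sum_left inner_Basis
        fun_eq_iff if_distrib[of "\<lambda>x. _ * x"] sum.If_cases cong: if_cong)
  have int: "(\<integral>\<^sup>+y. u y \<partial>lborel) = (\<integral>\<^sup>+w. u (e w) \<partial>?L)" if [measurable]: "u \<in> borel_measurable borel" for u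
    unfolding lborel by (simp add: nn_integral_distr)
  have dens: "density lborel u = distr (density ?L (\<lambda>w. u (e w))) borel e"
    if [measurable]: "u \<in> borel_measurable borel" for u
    unfolding lborel by (rule density_distr) simp_all
  have "\<exists>S q. interpolating_transport Basis (\<lambda>w. g (e w)) (\<lambda>w. f (e w)) S q"
    using assms pos by (intro interpolating_transport_exists) (simp_all add: int)
  then obtain S q where "interpolating_transport Basis (\<lambda>w. g (e w)) (\<lambda>w. f (e w)) S q" by blast
  then have S [measurable]: "S \<in> ?L \<rightarrow>\<^sub>M ?L"
    and q: "\<And>i. i \<in> Basis \<Longrightarrow> q i \<in> borel_measurable ?L"
    and distr_S: "distr (density ?L (\<lambda>w. g (e w))) ?L S = density ?L (\<lambda>w. f (e w))"
    and jac: "AE w in ?L. 0 < g (e w) \<longrightarrow> (\<Prod>i\<in>Basis. q i w) * f (e (S w)) = g (e w)"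
    and interp: "\<And>t \<phi>. 0 < t \<Longrightarrow> t < 1 \<Longrightarrow> \<phi> \<in> borel_measurable ?L \<Longrightarrow>
        (\<integral>\<^sup>+w. \<phi> (\<lambda>i\<in>Basis. (1 - t) * S w i + t * w i)
             * (\<Prod>i\<in>Basis. ennreal t + ennreal (1 - t) * q i w) * indicator {w. 0 < g (e w)} w
          \<partial>?L) \<le> (\<integral>\<^sup>+z. \<phi> z \<partial>?L)"
    by (auto simp: interpolating_transport_def)
  have qd: "(\<lambda>y. q b (d y)) \<in> borel_measurable borel" if "b \<in> Basis" for b
    using measurable_compose[OF d q[OF that]] .
  show thesis
  proof (rule that[of "\<lambda>y. e (S (d y))" "\<lambda>b y. q b (d y)"])
    show "(\<lambda>y. e (S (d y))) \<in> borel \<rightarrow>\<^sub>M borel" by measurable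
    show "(\<lambda>y. q b (d y)) \<in> borel_measurable borel" if "b \<in> Basis" for b by (rule qd[OF that])
    have "distr (density lborel g) borel (\<lambda>y. e (S (d y)))
        = distr (density ?L (\<lambda>w. g (e w))) borel ((\<lambda>y. e (S (d y))) \<circ> e)"
      unfolding dens[OF g] by (rule distr_distr) measurable
    also have "\<dots> = distr (density ?L (\<lambda>w. g (e w))) borel (e \<circ> S)"
      by (rule distr_cong) (auto simp: de)
    also have "\<dots> = distr (distr (density ?L (\<lambda>w. g (e w))) ?L S) borel e"
      by (rule distr_distr[symmetric]) measurable
    also have "\<dots> = density lborel f" unfolding distr_S dens[OF f] ..
    finally show "distr (density lborel g) borel (\<lambda>y. e (S (d y))) = density lborel f" .
    show "AE y in lborel. 0 < g y \<longrightarrow> (\<Prod>b\<in>Basis. q b (d y)) * f (e (S (d y))) = g y"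
    proof -
      have [measurable]: "(\<lambda>y. \<Prod>b\<in>Basis. q b (d y)) \<in> borel_measurable borel"
        by (rule borel_measurable_prod_ennreal) (rule qd)
      have "AE w in ?L. 0 < g (e w) \<longrightarrow> (\<Prod>b\<in>Basis. q b (d (e w))) * f (e (S (d (e w)))) = g (e w)"
        using jac AE_space by eventually_elim (simp add: de)
      then show ?thesis unfolding lborel by (subst AE_distr_iff) (simp_all add: e)
    qed
    fix t :: real and \<phi> :: "'a \<Rightarrow> ennreal"
    assume t: "0 < t" "t < 1" and \<phi> [measurable]: "\<phi> \<in> borel_measurable borel"
    let ?j = "\<lambda>w. \<Prod>b\<in>Basis. ennreal t + ennreal (1 - t) * q b w"
    have [measurable]: "(\<lambda>y. ?j (d y)) \<in> borel_measurable borel"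
      using qd by (intro borel_measurable_prod_ennreal) simp
    have "(\<integral>\<^sup>+y. \<phi> ((1 - t) *\<^sub>R e (S (d y)) + t *\<^sub>R y) * ?j (d y) * indicator {y. 0 < g y} y \<partial>lborel)
        = (\<integral>\<^sup>+w. \<phi> ((1 - t) *\<^sub>R e (S (d (e w))) + t *\<^sub>R e w) * ?j (d (e w)) * indicator {y. 0 < g y} (e w) \<partial>?L)"
      by (rule int) (simp add: indicator_def)
    also have "\<dots> = (\<integral>\<^sup>+w. \<phi> (e (\<lambda>i\<in>Basis. (1 - t) * S w i + t * w i)) * ?j w * indicator {w. 0 < g (e w)} w \<partial>?L)"
    proof (rule nn_integral_cong)
      fix w assume w: "w \<in> space ?L"
      have "(1 - t) *\<^sub>R e (S w) + t *\<^sub>R e w = e (\<lambda>i\<in>Basis. (1 - t) * S w i + t * w i)"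
        by (simp add: e_def scaleR_sum_right scaleR_add_left sum.distrib)
      then show "\<phi> ((1 - t) *\<^sub>R e (S (d (e w))) + t *\<^sub>R e w) * ?j (d (e w)) * indicator {y. 0 < g y} (e w)
          = \<phi> (e (\<lambda>i\<in>Basis. (1 - t) * S w i + t * w i)) * ?j w * indicator {w. 0 < g (e w)} w"
        by (simp add: de[OF w] indicator_def)
    qed
    also have "\<dots> \<le> (\<integral>\<^sup>+w. \<phi> (e w) \<partial>?L)"
      by (rule interp[OF t, of "\<lambda>w. \<phi> (e w)"]) measurable
    also have "\<dots> = (\<integral>\<^sup>+z. \<phi> z \<partial>lborel)" by (rule int[symmetric]) fact
    finally show "(\<integral>\<^sup>+y. \<phi> ((1 - t) *\<^sub>R e (S (d y)) + t *\<^sub>R y) * ?j (d y) * indicator {y. 0 < g y} y \<partial>lborel)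
        \<le> (\<integral>\<^sup>+z. \<phi> z \<partial>lborel)" .
  qed
qed

section \<open>From a lower bound on the Hessian to strong convexity\<close>

lemma C1_has_derivative:
  assumes "C1 f"
  shows "(f has_derivative (\<lambda>v. \<Sum>i\<in>UNIV. v $ i * partial_deriv i f x)) (at x)"
proof -
  let ?D = "frechet_derivative f (at x)"
  have D: "(f has_derivative ?D) (at x)"
    using assms by (auto simp: C1_def frechet_derivative_works)
  then interpret bounded_linear ?D by (rule has_derivative_bounded_linear)
  have "?D v = (\<Sum>i\<in>UNIV. v $ i * partial_deriv i f x)" for v
  proof -
    have "?D v = ?D (\<Sum>i\<in>UNIV. v $ i *\<^sub>R axis i 1)"
      using basis_expansion[of v] by (simp add: scalar_mult_eq_scaleR)
    then show ?thesis by (simp add: sum scaleR partial_deriv_def)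
  qed
  then have "?D = (\<lambda>v. \<Sum>i\<in>UNIV. v $ i * partial_deriv i f x)" by (rule ext)
  from D[unfolded this] show ?thesis .
qed

lemma C1_deriv_along_line:
  assumes "C1 f"
  shows "((\<lambda>s. f (x + s *\<^sub>R v)) has_real_derivative (\<Sum>i\<in>UNIV. v $ i * partial_deriv i f (x + s *\<^sub>R v))) (at s)"
proof -
  have "((\<lambda>s. x + s *\<^sub>R v) has_derivative (\<lambda>h. h *\<^sub>R v)) (at s)"
    by (auto intro!: derivative_eq_intros)
  from has_derivative_compose[OF this C1_has_derivative[OF assms]] show ?thesis
    by (rule has_derivative_imp_has_field_derivative) (simp add: sum_distrib_left mult.assoc)
qed

text \<open>The second derivative of \<open>s \<mapsto> V (x + s v)\<close> is the quadratic form of the Hessian at \<open>v\<close>.  The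
  chain rule produces the form of the transposed matrix, which is the same form.\<close>
lemma Hess_lower_bound_imp_convex_along_line:
  fixes V :: "real ^ 'n \<Rightarrow> real"
  assumes "C2 V" and "\<And>x. loewner_le (R *\<^sub>R mat 1) (Hess V x)"
  shows "convex_on UNIV (\<lambda>s. V (x + s *\<^sub>R v) - R / 2 * (norm v)\<^sup>2 * s\<^sup>2)"
proof (rule f''_ge0_imp_convex)
  let ?p = "\<lambda>s. x + s *\<^sub>R v"
  fix s :: real
  have V: "C1 V" and V': "\<And>i. C1 (partial_deriv i V)" using assms(1) by (auto simp: C2_def)
  show "((\<lambda>s. V (?p s) - R / 2 * (norm v)\<^sup>2 * s\<^sup>2) has_real_derivative
      (\<Sum>i\<in>UNIV. v $ i * partial_deriv i V (?p s)) - R * (norm v)\<^sup>2 * s) (at s)"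
    by (rule derivative_eq_intros C1_deriv_along_line[OF V] refl | simp)+
  show "((\<lambda>s. (\<Sum>i\<in>UNIV. v $ i * partial_deriv i V (?p s)) - R * (norm v)\<^sup>2 * s) has_real_derivative
      (\<Sum>i\<in>UNIV. v $ i * (\<Sum>j\<in>UNIV. v $ j * partial_deriv j (partial_deriv i V) (?p s))) - R * (norm v)\<^sup>2) (at s)"
    by (rule derivative_eq_intros C1_deriv_along_line[OF V'] refl | simp add: mult.commute)+
  have "v \<bullet> ((R *\<^sub>R mat 1) *v v) \<le> v \<bullet> (Hess V (?p s) *v v)"
    using assms(2)[of "?p s"] unfolding loewner_le_def by blast
  also have "v \<bullet> ((R *\<^sub>R mat 1) *v v) = R * (norm v)\<^sup>2"
    by (simp add: scaleR_matrix_vector_assoc[symmetric] power2_norm_eq_inner)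
  also have "v \<bullet> (Hess V (?p s) *v v)
      = (\<Sum>i\<in>UNIV. \<Sum>j\<in>UNIV. v $ i * (partial_deriv i (partial_deriv j V) (?p s) * v $ j))"
    by (simp add: inner_vec_def matrix_vector_mult_def Hess_def sum_distrib_left)
  also have "\<dots> = (\<Sum>i\<in>UNIV. v $ i * (\<Sum>j\<in>UNIV. v $ j * partial_deriv j (partial_deriv i V) (?p s)))"
    by (subst sum.swap) (simp add: sum_distrib_left mult_ac)
  finally show "0 \<le> (\<Sum>i\<in>UNIV. v $ i * (\<Sum>j\<in>UNIV. v $ j * partial_deriv j (partial_deriv i V) (?p s))) - R * (norm v)\<^sup>2"
    by simp
qed simp

lemma Hess_lower_bound_imp_strongly_convex:
  fixes V :: "real ^ 'n \<Rightarrow> real"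
  assumes "C2 V" and "\<And>x. loewner_le (R *\<^sub>R mat 1) (Hess V x)" and t: "0 \<le> t" "t \<le> 1"
  shows "V ((1 - t) *\<^sub>R x + t *\<^sub>R y) \<le> (1 - t) * V x + t * V y - R / 2 * t * (1 - t) * (norm (y - x))\<^sup>2"
proof -
  have "x + t *\<^sub>R (y - x) = (1 - t) *\<^sub>R x + t *\<^sub>R y" by (simp add: algebra_simps)
  moreover have "V (x + t *\<^sub>R (y - x)) - R / 2 * (norm (y - x))\<^sup>2 * t\<^sup>2
      \<le> (1 - t) * V x + t * (V y - R / 2 * (norm (y - x))\<^sup>2)"
    using convex_onD[OF Hess_lower_bound_imp_convex_along_line[OF assms(1,2)] t, of 0 1 x "y - x"] by simp
  ultimately show ?thesis by (simp add: algebra_simps power2_eq_square diff_divide_distrib)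
qed

text \<open>Along every line through 0, \<open>V\<close> lies above a quadratic function with leading coefficient \<open>R / 2\<close> and
  linear coefficient given by the gradient \<open>p\<close> of \<open>V\<close> at 0.  Completing the square bounds these
  quadratic functions below independently of the line.\<close>
lemma Hess_lower_bound_imp_bounded_below:
  fixes V :: "real ^ 'n \<Rightarrow> real"
  assumes "C2 V" and "\<And>x. loewner_le (R *\<^sub>R mat 1) (Hess V x)" and R: "0 < R"
  obtains m where "\<And>x. m \<le> V x"
proof
  fix x
  have V: "C1 V" using assms(1) by (simp add: C2_def)
  define p where "p = (\<chi> i. partial_deriv i V 0)"
  have D: "((\<lambda>s. V (0 + s *\<^sub>R x) - R / 2 * (norm x)\<^sup>2 * s\<^sup>2) has_real_derivative x \<bullet> p) (at 0)"
    by (rule derivative_eq_intros C1_deriv_along_line[OF V] refl | simp add: inner_vec_def p_def)+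
  have "x \<bullet> p \<le> V x - R / 2 * (norm x)\<^sup>2 - V 0"
    using convex_on_imp_above_tangent[OF Hess_lower_bound_imp_convex_along_line[OF assms(1,2)] _ _ _ D, of 1] by simp
  moreover have "(norm (R *\<^sub>R x + p))\<^sup>2 = R\<^sup>2 * (norm x)\<^sup>2 + 2 * R * (x \<bullet> p) + (norm p)\<^sup>2"
    unfolding power2_norm_eq_inner by (simp add: inner_commute power2_eq_square algebra_simps)
  then have "0 \<le> R\<^sup>2 * (norm x)\<^sup>2 + 2 * R * (x \<bullet> p) + (norm p)\<^sup>2"
    by (metis zero_le_power2)
  then have "0 \<le> (R\<^sup>2 * (norm x)\<^sup>2 + 2 * R * (x \<bullet> p) + (norm p)\<^sup>2) / (2 * R)" using R by simp
  then have "0 \<le> R / 2 * (norm x)\<^sup>2 + x \<bullet> p + (norm p)\<^sup>2 / (2 * R)"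
    using R by (simp add: add_divide_distrib power2_eq_square)
  ultimately show "V 0 - (norm p)\<^sup>2 / (2 * R) \<le> V x" by simp
qed

lemma C2_continuous: "C2 V \<Longrightarrow> continuous_on UNIV V"
  by (simp add: C2_def C1_def continuous_at_imp_continuous_on differentiable_imp_continuous_within)

section \<open>Inequalities for the first-order expansion along the interpolation\<close>

text \<open>The limit \<open>t \<rightarrow> 0\<close>.  The inequality is divided by \<open>t\<close>, and \<open>ln (1 - t + t E) / t\<close> tends to the derivative
  \<open>E - 1\<close>.\<close>
lemma first_order_interpolation_bound:
  fixes a b c E :: real
  assumes "0 \<le> E" and ineq: "\<And>t. 0 < t \<Longrightarrow> t < 1 \<Longrightarrow> t * a + t * (1 - t) * b + c * ln (1 - t + t * E) \<le> 0"
  shows "a + b + c * (E - 1) \<le> 0"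
proof -
  have "((\<lambda>t. ln (1 - t + t * E)) has_real_derivative (E - 1)) (at 0)"
    by (auto intro!: derivative_eq_intros)
  then have "((\<lambda>t. ln (1 - t + t * E) / t) \<longlongrightarrow> E - 1) (at_right 0)"
    unfolding has_field_derivative_iff by (auto elim: filterlim_mono simp: at_within_le_at)
  then have "((\<lambda>t. a + (1 - t) * b + c * (ln (1 - t + t * E) / t)) \<longlongrightarrow> a + (1 - 0) * b + c * (E - 1)) (at_right 0)"
    by (intro tendsto_intros) auto
  moreover have "eventually (\<lambda>t. a + (1 - t) * b + c * (ln (1 - t + t * E) / t) \<le> 0) (at_right 0)"
    unfolding eventually_at_right_field
  proof (intro exI[of _ 1] conjI allI impI)
    fix t :: real assume t: "0 < t" "t < 1"
    have "(t * a + t * (1 - t) * b + c * ln (1 - t + t * E)) / t \<le> 0"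
      using ineq[OF t] t by (simp add: divide_le_0_iff)
    then show "a + (1 - t) * b + c * (ln (1 - t + t * E) / t) \<le> 0"
      using t by (simp add: add_divide_distrib)
  qed simp
  ultimately have "a + (1 - 0) * b + c * (E - 1) \<le> 0"
    by (intro tendsto_upperbound) auto
  then show ?thesis by simp
qed

text \<open>With \<open>u = - ln Q\<close>, this is the tangent at \<open>u = ln E\<close> of the convex function \<open>ln (1 - t + t exp u)\<close>.  Dividing
  by \<open>D = 1 - t + t E\<close> turns it into \<open>exp (w v) \<le> (1 - w) + w exp v\<close> for \<open>v = u - ln E\<close> and
  \<open>w = t E / D\<close>, which is convexity of \<open>exp\<close>.\<close>
lemma ln_interpolation_tangent:
  fixes t E Q :: real
  assumes t: "0 < t" "t < 1" and E: "0 < E" and Q: "0 < Q"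
  shows "ln (1 - t + t * E) + t * E / (1 - t + t * E) * (- ln Q - ln E) \<le> ln (1 - t + t / Q)"
proof -
  define D where "D = 1 - t + t * E"
  define w where "w = t * E / D"
  have D: "0 < D" using t E by (simp add: D_def add_pos_pos)
  have w: "0 \<le> w" "w \<le> 1" using t E D by (simp_all add: w_def D_def)
  have "exp (w * (- ln Q - ln E)) \<le> (1 - w) * exp 0 + w * exp (- ln Q - ln E)"
    using convex_onD[OF exp_convex w, of 0 "- ln Q - ln E"] by simp
  also have "exp (- ln Q - ln E) = 1 / (Q * E)"
    using E Q by (simp add: exp_diff exp_minus field_simps)
  also have "(1 - w) * exp 0 + w * (1 / (Q * E)) = (1 - t + t / Q) / D"
    using D E Q by (simp add: w_def field_simps) (simp add: D_def algebra_simps)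
  finally have le: "exp (w * (- ln Q - ln E)) \<le> (1 - t + t / Q) / D" .
  have pos: "0 < 1 - t + t / Q" using t Q by (intro add_pos_pos divide_pos_pos) auto
  have "w * (- ln Q - ln E) \<le> ln ((1 - t + t / Q) / D)"
    using le pos D by (subst ln_ge_iff) auto
  also have "\<dots> = ln (1 - t + t / Q) - ln D"
    using pos D by (subst ln_div) auto
  finally show ?thesis by (simp add: w_def D_def)
qed

text \<open>This is Jensen's inequality for \<open>exp\<close>, obtained by integrating \<open>1 + L \<le> exp L \<le> X\<close>.  Only the positive
  part of \<open>1 + L\<close> can be compared with the extended nonnegative function \<open>X\<close>.\<close>
lemma (in prob_space) integral_nonpos_if_exp_bound:
  assumes L: "integrable M L" and X: "(\<integral>\<^sup>+x. X x \<partial>M) \<le> 1" and le: "AE x in M. ennreal (exp (L x)) \<le> X x"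
  shows "(\<integral>x. L x \<partial>M) \<le> 0"
proof -
  let ?m = "\<lambda>x. max 0 (1 + L x)"
  have m: "integrable M ?m" using L by (intro integrable_max) auto
  have "ennreal (\<integral>x. ?m x \<partial>M) = (\<integral>\<^sup>+x. ennreal (?m x) \<partial>M)"
    by (rule nn_integral_eq_integral[symmetric, OF m]) simp
  also have "\<dots> \<le> (\<integral>\<^sup>+x. X x \<partial>M)"
  proof (rule nn_integral_mono_AE)
    show "AE x in M. ennreal (?m x) \<le> X x"
      using le
    proof eventually_elim
      case (elim x)
      have "ennreal (?m x) \<le> ennreal (exp (L x))"
        using exp_ge_add_one_self[of "L x"] by (intro ennreal_leI) simp
      from this elim show ?case by (rule order_trans)
    qed
  qed
  also note X
  finally have "(\<integral>x. ?m x \<partial>M) \<le> 1" by simp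
  moreover have "(\<integral>x. 1 + L x \<partial>M) \<le> (\<integral>x. ?m x \<partial>M)" using L m by (intro integral_mono) auto
  moreover have "(\<integral>x. 1 + L x \<partial>M) = 1 + (\<integral>x. L x \<partial>M)" using L prob_space by simp
  ultimately show ?thesis by simp
qed

text \<open>The pointwise estimate behind the transport bound.  Here \<open>Vx\<close>, \<open>Vy\<close>, \<open>Vz\<close> are the values of \<open>V\<close> at \<open>S y\<close>, \<open>y\<close>
  and the interpolated point, \<open>\<rho>\<close> is the density of \<open>\<nu>\<close> with respect to \<open>\<mu>\<close> and \<open>K\<close> is the gain from strong
  convexity.  Pulling the factors \<open>Q b\<close> out of the Jacobian, whose product is known, leaves the factors
  \<open>1 - t + t / Q b\<close>, and the tangent bound applies to each of them.  The tangents have the same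
  slope for all \<open>b\<close>, so the logarithms of the \<open>Q b\<close> enter through their sum, which the Jacobian determines.\<close>
lemma interpolation_pointwise_bound:
  fixes Q :: "'b \<Rightarrow> real"
  assumes t: "0 < t" "t < 1" and E: "0 < E" and Q: "\<And>b. b \<in> B \<Longrightarrow> 0 < Q b" and "finite B"
    and \<rho>: "0 < \<rho>" and jac: "(\<Prod>b\<in>B. Q b) = \<rho> * exp (Vx - Vy)"
    and conv: "Vz \<le> (1 - t) * Vx + t * Vy - K"
  shows "exp (t * (Vx - Vy) + K + (real (card B) * ln (1 - t + t * E)
        + t * E / (1 - t + t * E) * (Vy - Vx - ln \<rho> - real (card B) * ln E)))
      \<le> exp (- Vz) * (\<Prod>b\<in>B. t + (1 - t) * Q b) / (\<rho> * exp (- Vy))"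
proof -
  define w where "w = t * E / (1 - t + t * E)"
  have pos: "0 < 1 - t + t / Q b" if "b \<in> B" for b
    using t Q[OF that] by (intro add_pos_pos divide_pos_pos) auto
  have "ln (\<Prod>b\<in>B. Q b) = (\<Sum>b\<in>B. ln (Q b))"
    using Q \<open>finite B\<close> by (intro ln_prod) force+
  moreover have "ln (\<rho> * exp (Vx - Vy)) = ln \<rho> + (Vx - Vy)" using \<rho> by (simp add: ln_mult)
  ultimately have lnQ: "(\<Sum>b\<in>B. ln (Q b)) = ln \<rho> + (Vx - Vy)" using jac by simp
  have "real (card B) * ln (1 - t + t * E) + w * (Vy - Vx - ln \<rho> - real (card B) * ln E)
      = (\<Sum>b\<in>B. ln (1 - t + t * E) + w * (- ln (Q b) - ln E))"
    using lnQ by (simp add: sum.distrib sum_distrib_left[symmetric] sum_subtractf sum_negf)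
  also have "\<dots> \<le> (\<Sum>b\<in>B. ln (1 - t + t / Q b))"
    unfolding w_def using t E Q by (intro sum_mono ln_interpolation_tangent) auto
  also have "\<dots> = ln (\<Prod>b\<in>B. 1 - t + t / Q b)"
    using pos \<open>finite B\<close> by (intro ln_prod[symmetric]) force+
  finally have "t * (Vx - Vy) + K + (real (card B) * ln (1 - t + t * E) + w * (Vy - Vx - ln \<rho> - real (card B) * ln E))
      \<le> Vx - Vz + ln (\<Prod>b\<in>B. 1 - t + t / Q b)"
    using conv by (simp add: algebra_simps)
  then have "exp (t * (Vx - Vy) + K + (real (card B) * ln (1 - t + t * E) + w * (Vy - Vx - ln \<rho> - real (card B) * ln E)))
      \<le> exp (Vx - Vz + ln (\<Prod>b\<in>B. 1 - t + t / Q b))" by simp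
  also have "\<dots> = exp (Vx - Vz) * (\<Prod>b\<in>B. 1 - t + t / Q b)"
    using pos by (simp add: exp_add prod_pos)
  also have "\<dots> = exp (- Vz) * (\<Prod>b\<in>B. t + (1 - t) * Q b) / (\<rho> * exp (- Vy))"
  proof -
    have "(\<Prod>b\<in>B. t + (1 - t) * Q b) = (\<Prod>b\<in>B. Q b * (1 - t + t / Q b))"
    proof (intro prod.cong refl)
      fix b assume "b \<in> B"
      with Q have "0 < Q b" by blast
      then show "t + (1 - t) * Q b = Q b * (1 - t + t / Q b)" by (simp add: field_simps)
    qed
    also have "\<dots> = \<rho> * exp (Vx - Vy) * (\<Prod>b\<in>B. 1 - t + t / Q b)"
      unfolding prod.distrib jac ..
    finally show ?thesis using \<rho> by (simp add: exp_diff exp_minus field_simps)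
  qed
  finally show ?thesis by (simp add: w_def)
qed

section \<open>Cost bounds for strongly log-concave measures\<close>

lemma norm_diff_squared_le:
  fixes x y :: "'a :: real_inner"
  shows "(norm (y - x))\<^sup>2 \<le> 2 * (norm x)\<^sup>2 + 2 * (norm y)\<^sup>2"
proof -
  have "(norm (y - x))\<^sup>2 + (norm (y + x))\<^sup>2 = 2 * (norm x)\<^sup>2 + 2 * (norm y)\<^sup>2"
    unfolding power2_norm_eq_inner by (simp add: inner_diff inner_add inner_commute)
  then show ?thesis using zero_le_power2[of "norm (y + x)"] by linarith
qed

text \<open>The constants \<open>R\<close> and \<open>m\<close> are a modulus of strong convexity and a lower bound of \<open>V\<close>.\<close>
locale strongly_log_concave = prob_space \<mu> for \<mu> :: "('a :: euclidean_space) measure" +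
  fixes V :: "'a \<Rightarrow> real" and R m :: real
  assumes V_meas [measurable]: "V \<in> borel_measurable borel"
    and \<mu>_eq: "\<mu> = density lborel (\<lambda>x. ennreal (exp (- V x)))"
    and R_pos: "0 < R"
    and strongly_convex: "\<And>x y t. 0 \<le> t \<Longrightarrow> t \<le> 1 \<Longrightarrow>
      V ((1 - t) *\<^sub>R x + t *\<^sub>R y) \<le> (1 - t) * V x + t * V y - R / 2 * t * (1 - t) * (norm (y - x))\<^sup>2"
    and V_ge: "\<And>x. m \<le> V x"
    and second_moment: "integrable \<mu> (\<lambda>x. (norm x)\<^sup>2)"
begin

lemma sets_\<mu> [measurable_cong]: "sets \<mu> = sets borel" by (simp add: \<mu>_eq)

lemma integrable_norm_diff: "integrable \<mu> (\<lambda>x. (norm (y - x))\<^sup>2)"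
proof (rule Bochner_Integration.integrable_bound)
  show "integrable \<mu> (\<lambda>x. 2 * (norm x)\<^sup>2 + 2 * (norm y)\<^sup>2)" using second_moment by simp
  show "AE x in \<mu>. norm ((norm (y - x))\<^sup>2) \<le> norm (2 * (norm x)\<^sup>2 + 2 * (norm y)\<^sup>2)"
    using norm_diff_squared_le[of y] by (intro AE_I2) (auto intro: order_trans)
qed measurable

text \<open>Change of variables along \<open>x \<mapsto> (1 - t) x + t y\<close>, whose Jacobian is \<open>(1 - t)\<^sup>n\<close>.\<close>
lemma nn_integral_contraction:
  assumes t: "0 < t" "t < 1"
  shows "(\<integral>\<^sup>+x. ennreal (exp (V x - V ((1 - t) *\<^sub>R x + t *\<^sub>R y) + real DIM('a) * ln (1 - t))) \<partial>\<mu>) = 1"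
proof -
  have "1 = (\<integral>\<^sup>+x. ennreal (exp (- V x)) \<partial>lborel)"
    using emeasure_space_1 by (simp add: \<mu>_eq emeasure_density)
  also have "\<dots> = (\<integral>\<^sup>+x. ennreal (exp (- V x)) \<partial>density (distr lborel borel (\<lambda>x. t *\<^sub>R y + (1 - t) *\<^sub>R x)) (\<lambda>_. \<bar>1 - t\<bar> ^ DIM('a)))"
    using t by (subst (1) lborel_affine[of "1 - t" "t *\<^sub>R y"]) auto
  also have "\<dots> = (\<integral>\<^sup>+x. ennreal ((1 - t) ^ DIM('a)) * ennreal (exp (- V (t *\<^sub>R y + (1 - t) *\<^sub>R x))) \<partial>lborel)"
    using t by (simp add: nn_integral_density nn_integral_distr)
  also have "\<dots> = (\<integral>\<^sup>+x. ennreal (exp (- V x)) * ennreal (exp (V x - V ((1 - t) *\<^sub>R x + t *\<^sub>R y) + real DIM('a) * ln (1 - t))) \<partial>lborel)"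
  proof (rule nn_integral_cong)
    fix x
    have "(1 - t) ^ DIM('a) = exp (real DIM('a) * ln (1 - t))"
      using t by (simp add: exp_of_nat_mult)
    then show "ennreal ((1 - t) ^ DIM('a)) * ennreal (exp (- V (t *\<^sub>R y + (1 - t) *\<^sub>R x)))
        = ennreal (exp (- V x)) * ennreal (exp (V x - V ((1 - t) *\<^sub>R x + t *\<^sub>R y) + real DIM('a) * ln (1 - t)))"
      by (simp add: ennreal_mult[symmetric] exp_add[symmetric] add.commute)
  qed
  also have "\<dots> = (\<integral>\<^sup>+x. ennreal (exp (V x - V ((1 - t) *\<^sub>R x + t *\<^sub>R y) + real DIM('a) * ln (1 - t))) \<partial>\<mu>)"
    unfolding \<mu>_eq by (subst nn_integral_density) auto
  finally show ?thesis by simp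
qed

text \<open>For \<open>y = 0\<close> and \<open>t = 1/2\<close>, convexity bounds the exponent in the previous lemma below by half of \<open>V\<close> up to a
  constant.  As its exponential has integral 1, the positive part of \<open>V\<close> is integrable.\<close>
lemma V_integrable: "integrable \<mu> V"
proof -
  let ?n = "real DIM('a)"
  let ?X = "\<lambda>x. exp (V x - V ((1 - 1/2) *\<^sub>R x + (1/2) *\<^sub>R 0) + ?n * ln (1 - 1/2))"
  define C where "C = max 0 (V 0 - m - 2 - 2 * (?n * ln (1 - 1/2)))"
  have le: "V x - m \<le> 2 * ?X x + C" for x
  proof -
    have "V ((1 - 1/2) *\<^sub>R x + (1/2) *\<^sub>R 0) \<le> (1 - 1/2) * V x + (1/2) * V 0 - R / 2 * (1/2) * (1 - 1/2) * (norm (0 - x))\<^sup>2"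
      by (rule strongly_convex) auto
    also have "\<dots> \<le> (1 - 1/2) * V x + (1/2) * V 0" using R_pos by simp
    finally have "1 + (V x - V 0) / 2 + ?n * ln (1 - 1/2) \<le> ?X x"
      by (intro order_trans[OF _ exp_ge_add_one_self]) (simp add: field_simps)
    moreover have "V 0 - m - 2 - 2 * (?n * ln (1 - 1/2)) \<le> C" unfolding C_def by (rule max.cobounded2)
    ultimately show ?thesis by argo
  qed
  have "(\<integral>\<^sup>+x. ennreal (V x - m) \<partial>\<mu>) \<le> (\<integral>\<^sup>+x. ennreal 2 * ennreal (?X x) + ennreal C \<partial>\<mu>)"
  proof (rule nn_integral_mono)
    fix x
    have "ennreal (V x - m) \<le> ennreal (2 * ?X x + C)" using le by (rule ennreal_leI)
    also have "\<dots> = ennreal 2 * ennreal (?X x) + ennreal C"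
      by (subst ennreal_plus) (auto simp: C_def ennreal_mult)
    finally show "ennreal (V x - m) \<le> ennreal 2 * ennreal (?X x) + ennreal C" .
  qed
  also have "\<dots> = 2 + ennreal C"
    using emeasure_space_1 nn_integral_contraction[of "1/2" 0]
    by (subst nn_integral_add) (auto simp: nn_integral_cmult)
  finally have "(\<integral>\<^sup>+x. ennreal (V x - m) \<partial>\<mu>) < \<infinity>"
    by (rule le_less_trans) (simp add: ennreal_add_less_top less_top)
  then have "integrable \<mu> (\<lambda>x. V x - m)"
    using V_ge by (intro integrableI_nonneg) auto
  then have "integrable \<mu> (\<lambda>x. (V x - m) + m)" by (intro Bochner_Integration.integrable_add) auto
  then show ?thesis by simp
qed

text \<open>The transport argument for a single point \<open>y\<close>, with the contraction towards \<open>y\<close> as interpolation; this is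
  the case \<open>E = 0\<close> of the first-order expansion.  The first-order
  convexity inequality \<open>V y \<ge> V x + \<nabla>V(x) \<bullet> (y - x) + R/2 |y - x|\<^sup>2\<close> gives the same bound when it is averaged
  over \<open>x\<close> and integrated by parts.\<close>
lemma independent_coupling_bound:
  "R / 2 * (\<integral>x. (norm (y - x))\<^sup>2 \<partial>\<mu>) \<le> V y - (\<integral>x. V x \<partial>\<mu>) + real DIM('a)"
proof -
  let ?n = "real DIM('a)"
  have "(\<integral>x. V x \<partial>\<mu>) - V y + R / 2 * (\<integral>x. (norm (y - x))\<^sup>2 \<partial>\<mu>) + ?n * (0 - 1) \<le> 0"
  proof (rule first_order_interpolation_bound)
    fix t :: real assume t: "0 < t" "t < 1"
    let ?L = "\<lambda>x. t * (V x - V y) + t * (1 - t) * (R / 2 * (norm (y - x))\<^sup>2) + ?n * ln (1 - t)"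
    have L: "integrable \<mu> ?L" using V_integrable integrable_norm_diff by simp
    have "(\<integral>x. ?L x \<partial>\<mu>) \<le> 0"
    proof (rule integral_nonpos_if_exp_bound[OF L])
      show "(\<integral>\<^sup>+x. ennreal (exp (V x - V ((1 - t) *\<^sub>R x + t *\<^sub>R y) + ?n * ln (1 - t))) \<partial>\<mu>) \<le> 1"
        using nn_integral_contraction[OF t] by simp
      show "AE x in \<mu>. ennreal (exp (?L x)) \<le> ennreal (exp (V x - V ((1 - t) *\<^sub>R x + t *\<^sub>R y) + ?n * ln (1 - t)))"
      proof (intro AE_I2 ennreal_leI)
        fix x
        have "V ((1 - t) *\<^sub>R x + t *\<^sub>R y) \<le> (1 - t) * V x + t * V y - R / 2 * t * (1 - t) * (norm (y - x))\<^sup>2"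
          using t by (intro strongly_convex) auto
        then show "exp (?L x) \<le> exp (V x - V ((1 - t) *\<^sub>R x + t *\<^sub>R y) + ?n * ln (1 - t))"
          by (simp add: algebra_simps)
      qed
    qed
    also have "(\<integral>x. ?L x \<partial>\<mu>) = t * ((\<integral>x. V x \<partial>\<mu>) - V y)
        + t * (1 - t) * (R / 2 * (\<integral>x. (norm (y - x))\<^sup>2 \<partial>\<mu>)) + ?n * ln (1 - t)"
      using V_integrable integrable_norm_diff prob_space by simp
    finally show "t * ((\<integral>x. V x \<partial>\<mu>) - V y) + t * (1 - t) * (R / 2 * (\<integral>x. (norm (y - x))\<^sup>2 \<partial>\<mu>))
        + ?n * ln (1 - t + t * 0) \<le> 0" by simp
  qed simp
  then show ?thesis by simp
qed

text \<open>The main inequality for the triangular transport.  The exponent \<open>L\<close> collects the lower bounds from strong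
  convexity and from the tangent at \<open>ln E\<close>, and it involves the \<open>q b\<close> only through their product, which is a ratio of
  densities with integrable logarithm.  \<open>E\<close> is chosen so that the integral of the linear term of the tangent
  vanishes.\<close>
lemma transport_bound:
  fixes \<rho> :: "'a \<Rightarrow> real" and \<nu> :: "'a measure"
  assumes "prob_space \<nu>" and \<rho>_meas [measurable]: "\<rho> \<in> borel_measurable borel" and \<rho>_nonneg: "\<And>x. 0 \<le> \<rho> x"
    and \<nu>_eq: "\<nu> = density \<mu> (\<lambda>x. ennreal (\<rho> x))"
    and V_int: "integrable \<nu> V" and ln_int: "integrable \<nu> (\<lambda>x. ln (\<rho> x))"
    and moment: "integrable \<nu> (\<lambda>x. (norm x)\<^sup>2)"
  obtains S where "S \<in> borel \<rightarrow>\<^sub>M borel" "distr \<nu> borel S = \<mu>"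
    "R / 2 * (\<integral>y. (norm (y - S y))\<^sup>2 \<partial>\<nu>) \<le> (\<integral>y. V y \<partial>\<nu>) - (\<integral>x. V x \<partial>\<mu>) + real DIM('a)
      - real DIM('a) * exp (1 / real DIM('a) * ((\<integral>y. V y \<partial>\<nu>) - (\<integral>x. V x \<partial>\<mu>) - (\<integral>y. ln (\<rho> y) \<partial>\<nu>)))"
proof -
  interpret \<nu>: prob_space \<nu> by fact
  let ?n = "real DIM('a)"
  define f where "f x = ennreal (exp (- V x))" for x
  define g where "g x = ennreal (\<rho> x * exp (- V x))" for x
  have [measurable]: "f \<in> borel_measurable borel" "g \<in> borel_measurable borel"
    unfolding f_def g_def by measurable
  have \<mu>_f: "\<mu> = density lborel f" by (simp add: \<mu>_eq f_def[abs_def])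
  have \<nu>_g: "\<nu> = density lborel g"
    unfolding \<nu>_eq \<mu>_f by (subst density_density_eq) (auto simp: f_def g_def[abs_def] ennreal_mult[symmetric] \<rho>_nonneg mult.commute)
  have [measurable_cong]: "sets \<nu> = sets borel" by (simp add: \<nu>_g)
  have "(\<integral>\<^sup>+x. f x \<partial>lborel) = 1" "(\<integral>\<^sup>+x. g x \<partial>lborel) = 1" "\<And>x. 0 < f x"
    using emeasure_space_1 \<nu>.emeasure_space_1 by (simp_all add: \<mu>_f \<nu>_g emeasure_density f_def)
  then obtain S :: "'a \<Rightarrow> 'a" and q :: "'a \<Rightarrow> 'a \<Rightarrow> ennreal"
    where S [measurable]: "S \<in> borel \<rightarrow>\<^sub>M borel"
    and q: "\<And>b. b \<in> Basis \<Longrightarrow> q b \<in> borel_measurable borel"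
    and distr_S: "distr (density lborel g) borel S = density lborel f"
    and jac: "AE y in lborel. 0 < g y \<longrightarrow> (\<Prod>b\<in>Basis. q b y) * f (S y) = g y"
    and interp: "\<And>t \<phi>. 0 < t \<Longrightarrow> t < 1 \<Longrightarrow> \<phi> \<in> borel_measurable borel \<Longrightarrow>
      (\<integral>\<^sup>+y. \<phi> ((1 - t) *\<^sub>R S y + t *\<^sub>R y) * (\<Prod>b\<in>Basis. ennreal t + ennreal (1 - t) * q b y)
          * indicator {y. 0 < g y} y \<partial>lborel) \<le> (\<integral>\<^sup>+z. \<phi> z \<partial>lborel)"
    by (rule interpolating_transport_euclidean[rotated 2]) auto
  have distr_\<nu>: "distr \<nu> borel S = \<mu>" using distr_S by (simp add: \<mu>_f \<nu>_g)
  have VS_int: "integrable \<nu> (\<lambda>y. V (S y))" and VS: "(\<integral>y. V (S y) \<partial>\<nu>) = (\<integral>x. V x \<partial>\<mu>)"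
    using V_integrable unfolding distr_\<nu>[symmetric] by (simp_all add: integrable_distr_eq integral_distr)
  have S_moment: "integrable \<nu> (\<lambda>y. (norm (S y))\<^sup>2)"
    using second_moment unfolding distr_\<nu>[symmetric] by (simp add: integrable_distr_eq)
  have cost_int: "integrable \<nu> (\<lambda>y. (norm (y - S y))\<^sup>2)"
  proof (rule Bochner_Integration.integrable_bound)
    show "integrable \<nu> (\<lambda>y. 2 * (norm (S y))\<^sup>2 + 2 * (norm y)\<^sup>2)" using moment S_moment by simp
    show "AE y in \<nu>. norm ((norm (y - S y))\<^sup>2) \<le> norm (2 * (norm (S y))\<^sup>2 + 2 * (norm y)\<^sup>2)"
      using norm_diff_squared_le by (intro AE_I2) (auto intro: order_trans)
  qed measurable
  \<comment> \<open>\<open>E\<close> is the exponential in the conclusion.  Its logarithm, by \<open>lnE\<close> below, makes the linear term of the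
      tangent vanish in the mean.\<close>
  define E where "E = exp (1 / ?n * ((\<integral>y. V y \<partial>\<nu>) - (\<integral>x. V x \<partial>\<mu>) - (\<integral>y. ln (\<rho> y) \<partial>\<nu>)))"
  have E: "0 < E" by (simp add: E_def)
  have lnE: "?n * ln E = (\<integral>y. V y \<partial>\<nu>) - (\<integral>x. V x \<partial>\<mu>) - (\<integral>y. ln (\<rho> y) \<partial>\<nu>)"
    by (simp add: E_def)
  have "(\<integral>x. V x \<partial>\<mu>) - (\<integral>y. V y \<partial>\<nu>) + R / 2 * (\<integral>y. (norm (y - S y))\<^sup>2 \<partial>\<nu>) + ?n * (E - 1) \<le> 0"
  proof (rule first_order_interpolation_bound)
    fix t :: real assume t: "0 < t" "t < 1"
    let ?D = "1 - t + t * E"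
    let ?w = "t * E / ?D"
    let ?z = "\<lambda>y. (1 - t) *\<^sub>R S y + t *\<^sub>R y"
    let ?j = "\<lambda>y. \<Prod>b\<in>Basis. ennreal t + ennreal (1 - t) * q b y"
    define L where "L y = t * (V (S y) - V y) + R / 2 * t * (1 - t) * (norm (y - S y))\<^sup>2
      + (?n * ln ?D + ?w * (V y - V (S y) - ln (\<rho> y) - ?n * ln E))" for y
    define X where "X y = f (?z y) * ?j y / g y" for y
    have [measurable]: "?j \<in> borel_measurable borel"
      using q by (intro borel_measurable_prod_ennreal) simp
    have [measurable]: "X \<in> borel_measurable borel" unfolding X_def by measurable
    have L_int: "integrable \<nu> L"
      unfolding L_def using VS_int V_int ln_int cost_int by simp
    have "(\<integral>y. L y \<partial>\<nu>) \<le> 0"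
    proof (rule \<nu>.integral_nonpos_if_exp_bound[OF L_int])
      have "(\<integral>\<^sup>+y. X y \<partial>\<nu>) = (\<integral>\<^sup>+y. g y * X y \<partial>lborel)"
        unfolding \<nu>_g by (subst nn_integral_density) auto
      also have "\<dots> \<le> (\<integral>\<^sup>+y. f (?z y) * ?j y * indicator {y. 0 < g y} y \<partial>lborel)"
      proof (rule nn_integral_mono)
        fix y
        show "g y * X y \<le> f (?z y) * ?j y * indicator {y. 0 < g y} y"
        proof (cases "0 < g y")
          case True
          then have "f (?z y) * ?j y / g y * g y = f (?z y) * ?j y"
            by (rule ennreal_divide_mult_cancel) (simp add: g_def)
          with True show ?thesis by (simp add: X_def mult.commute)
        qed simp
      qed
      also have "\<dots> \<le> (\<integral>\<^sup>+z. f z \<partial>lborel)" by (rule interp[OF t]) simp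
      finally show "(\<integral>\<^sup>+y. X y \<partial>\<nu>) \<le> 1" by (simp add: \<open>(\<integral>\<^sup>+x. f x \<partial>lborel) = 1\<close>)
      have "AE y in lborel. 0 < g y \<longrightarrow> ennreal (exp (L y)) \<le> X y"
        using jac
      proof (eventually_elim, intro impI)
        fix y assume "0 < g y" and "0 < g y \<longrightarrow> (\<Prod>b\<in>Basis. q b y) * f (S y) = g y"
        then have P: "(\<Prod>b\<in>Basis. q b y) * f (S y) = g y" by simp
        have \<rho>: "0 < \<rho> y" using \<open>0 < g y\<close> by (simp add: g_def zero_less_mult_iff)
        define Q where "Q b = enn2real (q b y)" for b
        \<comment> \<open>The product of the \<open>q b y\<close> is a ratio of finite positive densities, so it is neither 0 nor \<open>\<infinity>\<close>, and
            neither is any of the factors.\<close>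
        have nz: "\<forall>b\<in>Basis. q b y \<noteq> 0"
          using P \<open>0 < g y\<close> by (metis finite_Basis less_irrefl mult_zero_left prod_zero)
        have "(\<Prod>b\<in>Basis. q b y) \<noteq> \<infinity>"
        proof
          assume "(\<Prod>b\<in>Basis. q b y) = \<infinity>"
          with P have "g y = \<infinity>" by (simp add: f_def ennreal_top_mult)
          then show False by (simp add: g_def)
        qed
        with nz have fin: "q b y \<noteq> \<infinity>" if "b \<in> Basis" for b
          using that by (auto simp: ennreal_prod_eq_top)
        have qQ: "q b y = ennreal (Q b)" if "b \<in> Basis" for b
          using fin[OF that] by (simp add: Q_def less_top)
        have Q: "0 < Q b" if "b \<in> Basis" for b
          using fin[OF that] nz that by (auto simp: Q_def enn2real_positive_iff less_top zero_less_iff_neq_zero)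
        have "ennreal ((\<Prod>b\<in>Basis. Q b) * exp (- V (S y))) = ennreal (\<rho> y * exp (- V y))"
          using P Q by (simp add: qQ g_def f_def prod_ennreal ennreal_mult less_imp_le prod_nonneg cong: prod.cong)
        then have "(\<Prod>b\<in>Basis. Q b) * exp (- V (S y)) = \<rho> y * exp (- V y)"
          using Q \<rho> by (subst (asm) ennreal_inj) (simp_all add: prod_nonneg less_imp_le)
        then have jacQ: "(\<Prod>b\<in>Basis. Q b) = \<rho> y * exp (V (S y) - V y)"
          by (simp add: exp_diff exp_minus field_simps)
        have "exp (L y) \<le> exp (- V (?z y)) * (\<Prod>b\<in>Basis. t + (1 - t) * Q b) / (\<rho> y * exp (- V y))"
          unfolding L_def using t
          by (intro interpolation_pointwise_bound[OF t E Q _ \<rho> jacQ] strongly_convex) auto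
        then have "ennreal (exp (L y)) \<le> ennreal (exp (- V (?z y)) * (\<Prod>b\<in>Basis. t + (1 - t) * Q b) / (\<rho> y * exp (- V y)))"
          by (rule ennreal_leI)
        also have "\<dots> = X y"
        proof -
          have nonneg: "0 \<le> t + (1 - t) * Q b" if "b \<in> Basis" for b
            using t Q[OF that] by (intro add_nonneg_nonneg mult_nonneg_nonneg) auto
          have "?j y = (\<Prod>b\<in>Basis. ennreal (t + (1 - t) * Q b))"
            using t Q by (intro prod.cong) (auto simp: qQ ennreal_mult less_imp_le)
          also have "\<dots> = ennreal (\<Prod>b\<in>Basis. t + (1 - t) * Q b)"
            using nonneg by (rule prod_ennreal)
          finally have j: "?j y = ennreal (\<Prod>b\<in>Basis. t + (1 - t) * Q b)" .
          have "0 \<le> (\<Prod>b\<in>Basis. t + (1 - t) * Q b)"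
            using nonneg by (intro prod_nonneg)
          then show ?thesis
            unfolding X_def j f_def g_def using \<rho> by (simp add: ennreal_mult[symmetric] divide_ennreal)
        qed
        finally show "ennreal (exp (L y)) \<le> X y" .
      qed
      then show "AE y in \<nu>. ennreal (exp (L y)) \<le> X y"
        unfolding \<nu>_g by (subst AE_density) auto
    qed
    also have "(\<integral>y. L y \<partial>\<nu>) = t * ((\<integral>x. V x \<partial>\<mu>) - (\<integral>y. V y \<partial>\<nu>)) + R / 2 * t * (1 - t) * (\<integral>y. (norm (y - S y))\<^sup>2 \<partial>\<nu>)
        + (?n * ln ?D + ?w * ((\<integral>y. V y \<partial>\<nu>) - (\<integral>x. V x \<partial>\<mu>) - (\<integral>y. ln (\<rho> y) \<partial>\<nu>) - ?n * ln E))"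
      unfolding L_def using VS_int V_int ln_int cost_int VS \<nu>.prob_space by simp
    also have "\<dots> = t * ((\<integral>x. V x \<partial>\<mu>) - (\<integral>y. V y \<partial>\<nu>)) + R / 2 * t * (1 - t) * (\<integral>y. (norm (y - S y))\<^sup>2 \<partial>\<nu>)
        + ?n * ln ?D" unfolding lnE by simp
    finally show "t * ((\<integral>x. V x \<partial>\<mu>) - (\<integral>y. V y \<partial>\<nu>)) + t * (1 - t) * (R / 2 * (\<integral>y. (norm (y - S y))\<^sup>2 \<partial>\<nu>))
        + ?n * ln ?D \<le> 0" by (simp add: mult_ac)
  qed (use E in simp)
  then show thesis
    by (intro that[OF S distr_\<nu>]) (simp add: E_def algebra_simps)
qed

end

lemma (in strongly_log_concave) independent_coupling_cost:
  fixes \<nu> :: "'a measure"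
  assumes "prob_space \<nu>" and [measurable_cong]: "sets \<nu> = sets borel"
    and V_int: "integrable \<nu> V"
  shows "R / 2 * (\<integral>(x, y). (norm (y - x))\<^sup>2 \<partial>(\<mu> \<Otimes>\<^sub>M \<nu>))
    \<le> (\<integral>y. V y \<partial>\<nu>) - (\<integral>x. V x \<partial>\<mu>) + real DIM('a)"
proof -
  interpret \<nu>: prob_space \<nu> by fact
  interpret pair_sigma_finite \<mu> \<nu> ..
  let ?c = "\<lambda>(x, y). (norm (y - x))\<^sup>2 :: real"
  let ?I = "\<lambda>y. \<integral>x. (norm (y - x))\<^sup>2 \<partial>\<mu>"
  let ?B = "\<lambda>y. 2 / R * (V y - (\<integral>x. V x \<partial>\<mu>) + real DIM('a))"
  have I_le: "?I y \<le> ?B y" for y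
    using independent_coupling_bound[of y] R_pos by (simp add: field_simps)
  have I_nonneg: "0 \<le> ?I y" for y by simp
  have [measurable]: "?I \<in> borel_measurable \<nu>" by measurable
  have I_int: "integrable \<nu> ?I"
  proof (rule Bochner_Integration.integrable_bound)
    show "integrable \<nu> ?B" using V_int by simp
    show "AE y in \<nu>. norm (?I y) \<le> norm (?B y)"
      unfolding real_norm_def abs_of_nonneg[OF I_nonneg] by (intro AE_I2 order_trans[OF I_le abs_ge_self])
  qed measurable
  have "integrable (\<mu> \<Otimes>\<^sub>M \<nu>) ?c \<longleftrightarrow> integrable (\<nu> \<Otimes>\<^sub>M \<mu>) (\<lambda>(y, x). ?c (x, y))"
    by (rule integrable_product_swap_iff[symmetric])
  also have "integrable (\<nu> \<Otimes>\<^sub>M \<mu>) (\<lambda>(y, x). ?c (x, y))"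
  proof -
    interpret Q: pair_sigma_finite \<nu> \<mu> ..
    show ?thesis
      by (rule Q.Fubini_integrable) (use I_int integrable_norm_diff in \<open>auto simp: case_prod_beta\<close>)
  qed
  finally have "(\<integral>(x, y). (norm (y - x))\<^sup>2 \<partial>(\<mu> \<Otimes>\<^sub>M \<nu>)) = (\<integral>y. ?I y \<partial>\<nu>)"
    by (subst integral_snd[symmetric]) auto
  also have "\<dots> \<le> (\<integral>y. ?B y \<partial>\<nu>)"
    using I_int V_int I_le by (intro integral_mono) auto
  also have "\<dots> = 2 / R * ((\<integral>y. V y \<partial>\<nu>) - (\<integral>x. V x \<partial>\<mu>) + real DIM('a))"
    using V_int \<nu>.prob_space by simp
  finally show ?thesis using R_pos by (simp add: field_simps)
qed

section \<open>Couplings, extended integrals and relative entropy\<close>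

lemma P2_D:
  assumes "\<nu> \<in> P2"
  shows "prob_space \<nu>" "sets \<nu> = sets borel" "integrable \<nu> (\<lambda>x. (norm x)\<^sup>2)"
  using assms by (simp_all add: P2_def)

lemma W2_squared_le:
  assumes "\<pi> \<in> couplings \<mu> \<nu>"
  shows "(W2 \<mu> \<nu>)\<^sup>2 \<le> (\<integral>(x, y). (norm (y - x))\<^sup>2 \<partial>\<pi>)"
proof -
  let ?c = "\<lambda>\<pi>. \<integral>(x, y). (norm (y - x))\<^sup>2 \<partial>\<pi>"
  have c: "0 \<le> ?c \<pi>" for \<pi> by (intro integral_nonneg_AE) (auto simp: case_prod_beta)
  have "W2 \<mu> \<nu> \<le> sqrt (?c \<pi>)"
    unfolding W2_def using assms c by (intro cINF_lower bdd_belowI2[where m=0]) auto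
  moreover have "0 \<le> W2 \<mu> \<nu>"
    unfolding W2_def using assms c by (intro cINF_greatest) auto
  ultimately have "(W2 \<mu> \<nu>)\<^sup>2 \<le> (sqrt (?c \<pi>))\<^sup>2" by (intro power_mono)
  then show ?thesis using c[of \<pi>] by (simp only: real_sqrt_pow2)
qed

lemma product_coupling:
  assumes "prob_space \<mu>" "sets \<mu> = sets borel" "prob_space \<nu>" "sets \<nu> = sets borel"
  shows "\<mu> \<Otimes>\<^sub>M \<nu> \<in> couplings \<mu> \<nu>"
proof -
  interpret \<mu>: prob_space \<mu> by fact
  interpret \<nu>: prob_space \<nu> by fact
  interpret pair_prob_space \<mu> \<nu> ..
  have sets: "sets (\<mu> \<Otimes>\<^sub>M \<nu>) = sets (borel \<Otimes>\<^sub>M borel)"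
    using assms by (intro sets_pair_measure_cong)
  have "distr (\<mu> \<Otimes>\<^sub>M \<nu>) borel fst = distr (\<mu> \<Otimes>\<^sub>M \<nu>) \<mu> fst"
    using assms by (intro distr_cong) auto
  moreover have "distr (\<mu> \<Otimes>\<^sub>M \<nu>) borel snd = distr (\<mu> \<Otimes>\<^sub>M \<nu>) \<nu> snd"
    using assms by (intro distr_cong) auto
  moreover have "distr (\<mu> \<Otimes>\<^sub>M \<nu>) \<nu> snd = \<nu>"
  proof -
    have "distr (\<mu> \<Otimes>\<^sub>M \<nu>) \<nu> snd = distr (distr (\<nu> \<Otimes>\<^sub>M \<mu>) (\<mu> \<Otimes>\<^sub>M \<nu>) (\<lambda>(x, y). (y, x))) \<nu> snd"
      by (subst distr_pair_swap) simp
    also have "\<dots> = distr (\<nu> \<Otimes>\<^sub>M \<mu>) \<nu> fst"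
      by (subst distr_distr) (auto simp: comp_def case_prod_beta)
    also have "\<dots> = \<nu>" by (rule \<mu>.distr_pair_fst)
    finally show ?thesis .
  qed
  moreover have "distr (\<mu> \<Otimes>\<^sub>M \<nu>) \<mu> fst = \<mu>" by (rule \<nu>.distr_pair_fst)
  ultimately show ?thesis
    using sets by (simp add: couplings_def prob_space_axioms)
qed

lemma map_coupling:
  assumes "prob_space \<nu>" and [measurable_cong]: "sets \<nu> = sets borel"
    and [measurable]: "S \<in> borel \<rightarrow>\<^sub>M borel" and "distr \<nu> borel S = \<mu>"
  shows "distr \<nu> (borel \<Otimes>\<^sub>M borel) (\<lambda>y. (S y, y)) \<in> couplings \<mu> \<nu>"
proof -
  interpret \<nu>: prob_space \<nu> by fact
  show ?thesis
    using assms by (auto simp: couplings_def distr_distr comp_def distr_id2 intro!: \<nu>.prob_space_distr)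
qed

lemma ext_integral_eq_integral:
  assumes "integrable M f" shows "ext_integral M f = ereal (\<integral>x. f x \<partial>M)"
proof -
  have "(\<integral>\<^sup>+x. ennreal (f x) \<partial>M) < \<infinity>" "(\<integral>\<^sup>+x. ennreal (- f x) \<partial>M) < \<infinity>"
    using assms by (auto simp: real_integrable_def less_top)
  then show ?thesis
    unfolding ext_integral_def real_lebesgue_integral_def[OF assms]
    by (cases "\<integral>\<^sup>+x. ennreal (f x) \<partial>M"; cases "\<integral>\<^sup>+x. ennreal (- f x) \<partial>M") auto
qed

lemma ext_integral_eq_infinity:
  assumes "f \<in> borel_measurable M" "\<not> integrable M f" "(\<integral>\<^sup>+x. ennreal (- f x) \<partial>M) \<noteq> \<infinity>"
  shows "ext_integral M f = \<infinity>"
proof -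
  have "(\<integral>\<^sup>+x. ennreal (f x) \<partial>M) = \<infinity>" using assms by (auto simp: real_integrable_def)
  with assms(3) show ?thesis
    by (cases "\<integral>\<^sup>+x. ennreal (- f x) \<partial>M") (auto simp: ext_integral_def)
qed

lemma (in finite_measure) ext_integral_bounded_below:
  assumes [measurable]: "f \<in> borel_measurable M" and m: "\<And>x. m \<le> f x" and "ext_integral M f \<noteq> \<infinity>"
  shows "integrable M f"
proof (rule ccontr)
  assume "\<not> integrable M f"
  moreover have "(\<integral>\<^sup>+x. ennreal (- f x) \<partial>M) \<le> (\<integral>\<^sup>+x. ennreal (- m) \<partial>M)"
    using m by (intro nn_integral_mono ennreal_leI) simp
  then have "(\<integral>\<^sup>+x. ennreal (- f x) \<partial>M) \<noteq> \<infinity>"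
    by (auto simp: top_unique ennreal_mult_eq_top_iff emeasure_finite)
  ultimately show False using ext_integral_eq_infinity assms by blast
qed

text \<open>Since \<open>\<rho> ln \<rho> \<ge> - 1\<close>, the entropy is either infinite or the integral of an integrable function, and
  in the second case it equals the integral of \<open>ln \<rho>\<close> against \<open>\<nu>\<close>.\<close>
lemma rel_entropy_cases:
  fixes \<mu> \<nu> :: "'a measure"
  assumes "prob_space \<mu>" "prob_space \<nu>" and sets: "sets \<nu> = sets \<mu>"
  obtains (infinite) "rel_entropy \<nu> \<mu> = \<infinity>"
  | (finite) \<rho> where "\<rho> \<in> borel_measurable \<mu>" "\<And>x. 0 \<le> \<rho> x" "\<nu> = density \<mu> (\<lambda>x. ennreal (\<rho> x))"
      "integrable \<nu> (\<lambda>x. ln (\<rho> x))" "rel_entropy \<nu> \<mu> = ereal (\<integral>x. ln (\<rho> x) \<partial>\<nu>)"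
proof (cases "absolutely_continuous \<mu> \<nu>")
  case False
  then show ?thesis by (intro infinite) (simp add: rel_entropy_def)
next
  case ac: True
  interpret \<mu>: prob_space \<mu> by fact
  interpret \<nu>: prob_space \<nu> by fact
  define \<rho> where "\<rho> x = enn2real (RN_deriv \<mu> \<nu> x)" for x
  have [measurable]: "\<rho> \<in> borel_measurable \<mu>" unfolding \<rho>_def by measurable
  have \<rho>_nonneg: "0 \<le> \<rho> x" for x by (simp add: \<rho>_def)
  have "AE x in \<mu>. RN_deriv \<mu> \<nu> x = ennreal (\<rho> x)"
    using \<mu>.RN_deriv_finite[OF \<nu>.sigma_finite_measure_axioms ac sets]
    by eventually_elim (simp add: \<rho>_def less_top)
  then have "density \<mu> (RN_deriv \<mu> \<nu>) = density \<mu> (\<lambda>x. ennreal (\<rho> x))"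
    by (intro density_cong) auto
  then have \<nu>_eq: "\<nu> = density \<mu> (\<lambda>x. ennreal (\<rho> x))"
    using \<mu>.density_RN_deriv[OF ac sets] by simp
  have H: "rel_entropy \<nu> \<mu> = ext_integral \<mu> (\<lambda>x. \<rho> x * ln (\<rho> x))"
    using ac by (simp add: rel_entropy_def \<rho>_def Let_def)
  show ?thesis
  proof (cases "integrable \<mu> (\<lambda>x. \<rho> x * ln (\<rho> x))")
    case True
    then have "integrable \<nu> (\<lambda>x. ln (\<rho> x))" "(\<integral>x. ln (\<rho> x) \<partial>\<nu>) = (\<integral>x. \<rho> x * ln (\<rho> x) \<partial>\<mu>)"
      using \<rho>_nonneg by (auto simp: \<nu>_eq integrable_density integral_density)
    then show ?thesis
      using True by (intro finite[of \<rho>]) (auto simp: \<rho>_nonneg \<nu>_eq[symmetric] H ext_integral_eq_integral)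
  next
    case False
    have ge: "- 1 \<le> \<rho> x * ln (\<rho> x)" for x
    proof (cases "\<rho> x = 0")
      case False
      with \<rho>_nonneg[of x] have pos: "0 < \<rho> x" by simp
      have "ln (1 / \<rho> x) \<le> 1 / \<rho> x - 1" using pos by (intro ln_le_minus_one) simp
      then have "1 - 1 / \<rho> x \<le> ln (\<rho> x)" using pos by (simp add: ln_div)
      then have "\<rho> x * (1 - 1 / \<rho> x) \<le> \<rho> x * ln (\<rho> x)" using pos by (intro mult_left_mono) auto
      moreover have "\<rho> x * (1 - 1 / \<rho> x) = \<rho> x - 1" using pos by (simp add: field_simps)
      ultimately show ?thesis using pos by simp
    qed simp
    have "(\<lambda>x. \<rho> x * ln (\<rho> x)) \<in> borel_measurable \<mu>" by measurable
    from \<mu>.ext_integral_bounded_below[OF this ge] False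
    have "ext_integral \<mu> (\<lambda>x. \<rho> x * ln (\<rho> x)) = \<infinity>" by blast
    then show ?thesis by (intro infinite) (simp add: H)
  qed
qed

section \<open>The dimensional transport inequality\<close>

theorem theorem2p1:
  fixes V :: "real ^ 'n \<Rightarrow> real" and R :: real and \<mu> \<nu> :: "(real ^ 'n) measure"
  assumes "\<mu> \<in> P2"
    and "\<mu> = density lborel (\<lambda>x. ennreal (exp (- V x)))"
    and "C2 V"
    and "R > 0"
    and "\<forall>x. loewner_le (R *\<^sub>R mat 1) (Hess V x)"
    and "\<nu> \<in> P2"
  shows "ereal (R / 2 * (W2 \<mu> \<nu>)\<^sup>2) \<le>
    (if ext_integral \<nu> V = \<infinity> then \<infinity>
     else ext_integral \<nu> V - ext_integral \<mu> V + ereal (real CARD('n))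
          - ereal (real CARD('n)) *
            ext_exp (ereal (1 / real CARD('n)) *
              (ext_integral \<nu> V - ext_integral \<mu> V - rel_entropy \<nu> \<mu>)))"
proof (cases "ext_integral \<nu> V = \<infinity>")
  case False
  have hess: "\<And>x. loewner_le (R *\<^sub>R mat 1) (Hess V x)" using assms(5) by blast
  obtain m where m: "\<And>x. m \<le> V x"
    using Hess_lower_bound_imp_bounded_below[OF assms(3) hess assms(4)] by blast
  note P2_\<mu> = P2_D[OF assms(1)] and P2_\<nu> = P2_D[OF assms(6)]
  have V_meas [measurable]: "V \<in> borel_measurable borel"
    using C2_continuous[OF assms(3)] by (rule borel_measurable_continuous_onI)
  interpret \<nu>: prob_space \<nu> by (rule P2_\<nu>)
  interpret \<mu>: prob_space \<mu> by (rule P2_\<mu>)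
  interpret strongly_log_concave \<mu> V R m
    using V_meas assms(2,4) m P2_\<mu>(3) Hess_lower_bound_imp_strongly_convex[OF assms(3) hess]
    by unfold_locales auto
  have V_\<nu>: "integrable \<nu> V"
    using \<nu>.ext_integral_bounded_below[OF _ m False] P2_\<nu>(2) by (simp cong: measurable_cong_sets)
  define a where "a = (\<integral>y. V y \<partial>\<nu>) - (\<integral>x. V x \<partial>\<mu>)"
  have ext: "ext_integral \<nu> V = ereal (\<integral>y. V y \<partial>\<nu>)" "ext_integral \<mu> V = ereal (\<integral>x. V x \<partial>\<mu>)"
    using V_\<nu> V_integrable by (simp_all add: ext_integral_eq_integral)
  have half_cost: "R / 2 * (W2 \<mu> \<nu>)\<^sup>2 \<le> R / 2 * (\<integral>(x, y). (norm (y - x))\<^sup>2 \<partial>\<pi>)"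
    if "\<pi> \<in> couplings \<mu> \<nu>" for \<pi>
    using W2_squared_le[OF that] R_pos by (intro mult_left_mono) auto
  have "sets \<nu> = sets \<mu>" using P2_\<mu>(2) P2_\<nu>(2) by simp
  with P2_\<mu>(1) P2_\<nu>(1) show ?thesis
  proof (cases rule: rel_entropy_cases)
    case infinite
    have "R / 2 * (W2 \<mu> \<nu>)\<^sup>2 \<le> a + real CARD('n)"
      using half_cost[OF product_coupling[OF P2_\<mu>(1,2) P2_\<nu>(1,2)]]
        independent_coupling_cost[OF P2_\<nu>(1,2) V_\<nu>] by (simp add: a_def)
    then show ?thesis
      using False by (simp add: ext infinite ext_exp_def a_def)
  next
    case (finite \<rho>)
    have \<rho>_meas: "\<rho> \<in> borel_measurable borel"
      using finite(1) P2_\<mu>(2) by (simp cong: measurable_cong_sets)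
    obtain S where S [measurable]: "S \<in> borel \<rightarrow>\<^sub>M borel" and distr_S: "distr \<nu> borel S = \<mu>"
      and cost: "R / 2 * (\<integral>y. (norm (y - S y))\<^sup>2 \<partial>\<nu>) \<le> (\<integral>y. V y \<partial>\<nu>) - (\<integral>x. V x \<partial>\<mu>) + real DIM(real ^ 'n)
        - real DIM(real ^ 'n) * exp (1 / real DIM(real ^ 'n)
            * ((\<integral>y. V y \<partial>\<nu>) - (\<integral>x. V x \<partial>\<mu>) - (\<integral>y. ln (\<rho> y) \<partial>\<nu>)))"
      using transport_bound[OF P2_\<nu>(1) \<rho>_meas finite(2,3) V_\<nu> finite(4) P2_\<nu>(3)] by blast
    let ?\<pi> = "distr \<nu> (borel \<Otimes>\<^sub>M borel) (\<lambda>y. (S y, y))"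
    have [measurable_cong]: "sets \<nu> = sets borel" by (rule P2_\<nu>)
    have "(\<integral>(x, y). (norm (y - x))\<^sup>2 \<partial>?\<pi>) = (\<integral>y. (norm (y - S y))\<^sup>2 \<partial>\<nu>)"
      by (subst integral_distr) (auto simp: case_prod_beta)
    then have "R / 2 * (W2 \<mu> \<nu>)\<^sup>2 \<le> a + real CARD('n)
        - real CARD('n) * exp (1 / real CARD('n) * (a - (\<integral>y. ln (\<rho> y) \<partial>\<nu>)))"
      using half_cost[OF map_coupling[OF P2_\<nu>(1,2) S distr_S]] cost by (simp add: a_def)
    then show ?thesis
      using False by (simp add: ext finite(5) ext_exp_def a_def)
  qed
qed simp

end
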